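(* Let $m\ge1$ and let $\Omega$ be a bounded open set in $\mathbb{R}^n$, where either $n$ is odd with $3\le n\le 2m+1$, or $n$ is even with $2\le n\le 2m$. Let $k$ be an integer with $0\le k\le m-\frac n2+\frac12$ if $n$ is odd, and $0\le k\le m-\frac n2$ if $n$ is even. Let $1<p<\infty$ and let $w\in A_p(\mathbb{R}^n)$. Let $R(x,y)$ be the Green function of the polyharmonic Dirichlet problem $$(-\Delta)^m u=f \ \text{ in }\Omega,\qquad \left(\tfrac{\partial}{\partial\nu}\right)^j u=0\ \text{ on }\partial\Omega,\quad 0\le j\le m-1,$$ and let $u(x)=\int_\Omega R(x,y)f(y)\,dy$ be its solution. Then there exists a constant $C$, independent of $f$, such that $$\|u\|_{W^{k,p}_w(\Omega)}\le C\,\|f\|_{L^p(\Omega,w\,dx)}.$$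
   Context: $A_p(\mathbb{R}^n)$ is the usual Muckenhoupt class with respect to Lebesgue measure. $L^p(\Omega,w\,dx)$ has norm $\left(\int_\Omega|f|^pw\,dx\right)^{1/p}$. For a multi-index $\eta$, $|\eta|=\sum_j\eta_j$ and $D^\eta=\partial_{x_1}^{\eta_1}\cdots\partial_{x_n}^{\eta_n}$. The weighted Sobolev space is $W^{k,p}_w(\Omega)=\{v\in L^p(\Omega,w\,dx): D^\eta v\in L^p(\Omega,w\,dx)\ \forall |\eta|\le k\}$ with norm $\|v\|_{W^{k,p}_w(\Omega)}=\sum_{|\eta|\le k}\|D^\eta v\|_{L^p(\Omega,w\,dx)}$. Here $\frac{\partial}{\partial\nu}$ is the normal derivative; on a general bounded open set the homogeneous Dirichlet conditions are understood in the usual weak sense. A known fact (Mayboroda–Maz'ya) used as an assumption on the Green function: for $n$ as in the claim there is a constant $C$ with $|D^\eta R(x,y)|\le C|x-y|^{2m-n-|\eta|}$ (derivatives in $x$) for all $0\le|\eta|\le m-\frac n2+\frac12$ when $n$ is odd and all $0\le|\eta|\le m-\frac n2$ when $n$ is even. *)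

theory Defs
  imports "HOL-Analysis.Analysis"
begin

section \<open>Partial derivatives and multi-indices\<close>

text \<open>A multi-index is a function \<open>\<eta> :: 'n \<Rightarrow> nat\<close> on the finite coordinate type.\<close>

definition partial :: "'n::finite \<Rightarrow> (real^'n \<Rightarrow> real) \<Rightarrow> real^'n \<Rightarrow> real" where
  "partial i f x = deriv (\<lambda>t. f (x + t *\<^sub>R axis i 1)) 0"

definition mi_order :: "('n::finite \<Rightarrow> nat) \<Rightarrow> nat" where
  "mi_order \<eta> = (\<Sum>i\<in>UNIV. \<eta> i)"

text \<open>The type \<open>'n\<close> carries no order, so the coordinates are listed in some fixed order
  \<open>x\<^sub>1, \<dots>, x\<^sub>n\<close>. The derivatives below are only taken of functions smooth near the point
  considered, where the choice does not matter.\<close>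

definition coords :: "'n::finite list" where
  "coords = (SOME is. distinct is \<and> set is = UNIV)"

definition mderiv :: "('n::finite \<Rightarrow> nat) \<Rightarrow> (real^'n \<Rightarrow> real) \<Rightarrow> real^'n \<Rightarrow> real" where
  "mderiv \<eta> f = foldr (\<lambda>i g. (partial i ^^ \<eta> i) g) coords f"

definition smooth_on :: "(real^'n::finite) set \<Rightarrow> (real^'n \<Rightarrow> real) \<Rightarrow> bool" where
  "smooth_on S f \<longleftrightarrow> (\<forall>is. \<forall>x\<in>S. foldr partial is f differentiable (at x))"

definition laplacian :: "(real^'n::finite \<Rightarrow> real) \<Rightarrow> real^'n \<Rightarrow> real" where
  "laplacian f x = (\<Sum>i\<in>UNIV. partial i (partial i f) x)"

definition polyharmonic :: "nat \<Rightarrow> (real^'n::finite \<Rightarrow> real) \<Rightarrow> real^'n \<Rightarrow> real" where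
  "polyharmonic m = (\<lambda>f x. - laplacian f x) ^^ m"

lemma finite_mi_order_le: "finite {\<eta> :: 'n::finite \<Rightarrow> nat. mi_order \<eta> \<le> k}"
proof (rule finite_subset)
  show "{\<eta> :: 'n \<Rightarrow> nat. mi_order \<eta> \<le> k} \<subseteq> (UNIV :: 'n set) \<rightarrow>\<^sub>E {..k}"
  proof
    fix \<eta> :: "'n \<Rightarrow> nat" assume "\<eta> \<in> {\<eta>. mi_order \<eta> \<le> k}"
    then have "\<eta> i \<le> k" for i
      using member_le_sum[of i UNIV \<eta>] by (simp add: mi_order_def)
    then show "\<eta> \<in> UNIV \<rightarrow>\<^sub>E {..k}" by auto
  qed
  show "finite ((UNIV :: 'n set) \<rightarrow>\<^sub>E {..k})" by (simp add: finite_PiE)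
qed


section \<open>Muckenhoupt weights and weighted Lebesgue spaces\<close>

definition cube :: "real^'n::finite \<Rightarrow> real \<Rightarrow> (real^'n) set" where
  "cube a l = cbox a (a + (\<chi> i. l))"

definition average :: "(real^'n::finite) set \<Rightarrow> (real^'n \<Rightarrow> real) \<Rightarrow> real" where
  "average Q f = integral\<^sup>L (lebesgue_on Q) f / measure lebesgue Q"

text \<open>Positivity almost everywhere has to be required since \<open>0 powr a = 0\<close>, whereas
  \<open>w\<^bsup>-1/(p-1)\<^esup>\<close> is meant to be infinite where \<open>w\<close> vanishes.\<close>

definition muckenhoupt :: "real \<Rightarrow> (real^'n::finite \<Rightarrow> real) \<Rightarrow> bool" where
  "muckenhoupt p w \<longleftrightarrow>
     w \<in> borel_measurable lebesgue \<and> (\<forall>x. 0 \<le> w x) \<and> (AE x in lebesgue. 0 < w x) \<and>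
     (\<forall>a l. 0 < l \<longrightarrow> integrable (lebesgue_on (cube a l)) w \<and>
        integrable (lebesgue_on (cube a l)) (\<lambda>x. w x powr (- 1 / (p - 1)))) \<and>
     (\<exists>A. \<forall>a l. 0 < l \<longrightarrow>
        average (cube a l) w *
        average (cube a l) (\<lambda>x. w x powr (- 1 / (p - 1))) powr (p - 1) \<le> A)"

definition Lp_weighted ::
    "(real^'n::finite) set \<Rightarrow> (real^'n \<Rightarrow> real) \<Rightarrow> real \<Rightarrow> (real^'n \<Rightarrow> real) set" where
  "Lp_weighted \<Omega> w p =
     {f. f \<in> borel_measurable (lebesgue_on \<Omega>) \<and>
         integrable (lebesgue_on \<Omega>) (\<lambda>x. \<bar>f x\<bar> powr p * w x)}"

definition Lp_norm ::
    "(real^'n::finite) set \<Rightarrow> (real^'n \<Rightarrow> real) \<Rightarrow> real \<Rightarrow> (real^'n \<Rightarrow> real) \<Rightarrow> real" where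
  "Lp_norm \<Omega> w p f = (integral\<^sup>L (lebesgue_on \<Omega>) (\<lambda>x. \<bar>f x\<bar> powr p * w x)) powr (1 / p)"


section \<open>Weak derivatives and weighted Sobolev spaces\<close>

definition test_functions :: "(real^'n::finite) set \<Rightarrow> (real^'n \<Rightarrow> real) set" where
  "test_functions \<Omega> =
     {\<phi>. smooth_on UNIV \<phi> \<and> compact (closure {x. \<phi> x \<noteq> 0}) \<and> closure {x. \<phi> x \<noteq> 0} \<subseteq> \<Omega>}"

definition locally_integrable :: "(real^'n::finite) set \<Rightarrow> (real^'n \<Rightarrow> real) \<Rightarrow> bool" where
  "locally_integrable \<Omega> f \<longleftrightarrow> (\<forall>K. compact K \<and> K \<subseteq> \<Omega> \<longrightarrow> integrable (lebesgue_on K) f)"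

definition has_weak_deriv ::
    "(real^'n::finite) set \<Rightarrow> ('n \<Rightarrow> nat) \<Rightarrow> (real^'n \<Rightarrow> real) \<Rightarrow> (real^'n \<Rightarrow> real) \<Rightarrow> bool" where
  "has_weak_deriv \<Omega> \<eta> v g \<longleftrightarrow>
     locally_integrable \<Omega> v \<and> locally_integrable \<Omega> g \<and>
     (\<forall>\<phi>\<in>test_functions \<Omega>.
        integral\<^sup>L (lebesgue_on \<Omega>) (\<lambda>x. v x * mderiv \<eta> \<phi> x) =
        (- 1) ^ mi_order \<eta> * integral\<^sup>L (lebesgue_on \<Omega>) (\<lambda>x. g x * \<phi> x))"

text \<open>Weak derivatives are unique up to null sets, so norms of them do not depend on the choice.\<close>

definition weak_deriv ::
    "(real^'n::finite) set \<Rightarrow> ('n \<Rightarrow> nat) \<Rightarrow> (real^'n \<Rightarrow> real) \<Rightarrow> real^'n \<Rightarrow> real" where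
  "weak_deriv \<Omega> \<eta> v = (SOME g. has_weak_deriv \<Omega> \<eta> v g)"

definition sobolev ::
    "(real^'n::finite) set \<Rightarrow> (real^'n \<Rightarrow> real) \<Rightarrow> nat \<Rightarrow> real \<Rightarrow> (real^'n \<Rightarrow> real) set" where
  "sobolev \<Omega> w k p =
     {v \<in> Lp_weighted \<Omega> w p.
        \<forall>\<eta>. mi_order \<eta> \<le> k \<longrightarrow> (\<exists>g\<in>Lp_weighted \<Omega> w p. has_weak_deriv \<Omega> \<eta> v g)}"

definition sobolev_norm ::
    "(real^'n::finite) set \<Rightarrow> (real^'n \<Rightarrow> real) \<Rightarrow> nat \<Rightarrow> real \<Rightarrow> (real^'n \<Rightarrow> real) \<Rightarrow> real" where
  "sobolev_norm \<Omega> w k p v = (\<Sum>\<eta> | mi_order \<eta> \<le> k. Lp_norm \<Omega> w p (weak_deriv \<Omega> \<eta> v))"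

text \<open>The closure of the test functions in \<open>W\<^bsup>m,2\<^esup>(\<Omega>)\<close>: membership is the usual weak form of
  the homogeneous Dirichlet conditions \<open>(\<partial>/\<partial>\<nu>)\<^sup>j v = 0\<close>, \<open>j \<le> m - 1\<close>, on \<open>\<partial>\<Omega>\<close>.\<close>

definition sobolev0 :: "(real^'n::finite) set \<Rightarrow> nat \<Rightarrow> (real^'n \<Rightarrow> real) set" where
  "sobolev0 \<Omega> m =
     {v \<in> sobolev \<Omega> (\<lambda>_. 1) m 2.
        \<exists>\<phi>. (\<forall>j::nat. \<phi> j \<in> test_functions \<Omega>) \<and>
            (\<lambda>j. sobolev_norm \<Omega> (\<lambda>_. 1) m 2 (\<lambda>x. v x - \<phi> j x)) \<longlonglongrightarrow> 0}"


section \<open>The Green function of the polyharmonic Dirichlet problem\<close>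

text \<open>For every pole \<open>y\<close>, \<open>(-\<Delta>)\<^sup>m R(\<cdot>, y) = \<delta>\<^sub>y\<close> in the sense of distributions. Near \<open>y\<close> the
  function \<open>R(\<cdot>, y)\<close> need not have finite energy, so the Dirichlet conditions are imposed after
  cutting off a neighbourhood of \<open>y\<close>. These two requirements determine \<open>R(\<cdot>, y)\<close> almost
  everywhere; smoothness away from \<open>y\<close> (which holds by hypoellipticity) selects the classical
  representative, and measurability in both variables makes \<open>\<integral> R(x,y) f(y) dy\<close> meaningful.\<close>

definition polyharmonic_green ::
    "(real^'n::finite) set \<Rightarrow> nat \<Rightarrow> (real^'n \<Rightarrow> real^'n \<Rightarrow> real) \<Rightarrow> bool" where
  "polyharmonic_green \<Omega> m R \<longleftrightarrow>
     (\<lambda>(x, y). R x y) \<in> borel_measurable (restrict_space borel (\<Omega> \<times> \<Omega>)) \<and>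
     (\<forall>y\<in>\<Omega>.
        smooth_on (\<Omega> - {y}) (\<lambda>x. R x y) \<and>
        locally_integrable \<Omega> (\<lambda>x. R x y) \<and>
        (\<forall>\<phi>\<in>test_functions \<Omega>.
           integral\<^sup>L (lebesgue_on \<Omega>) (\<lambda>x. R x y * polyharmonic m \<phi> x) = \<phi> y) \<and>
        (\<forall>\<zeta>\<in>test_functions \<Omega>. (\<forall>\<^sub>F x in nhds y. \<zeta> x = 1) \<longrightarrow>
           (\<lambda>x. (1 - \<zeta> x) * R x y) \<in> sobolev0 \<Omega> m))"

text \<open>The largest order of differentiation, \<open>m - n/2 + 1/2\<close> for odd \<open>n\<close> and \<open>m - n/2\<close> for even
  \<open>n\<close>.\<close>

definition max_order :: "nat \<Rightarrow> nat \<Rightarrow> real" where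
  "max_order n m = (if odd n then real m - real n / 2 + 1 / 2 else real m - real n / 2)"

text \<open>Pointwise bounds of Mayboroda--Maz'ya type. With \<open>r = |x - y|\<close> and \<open>s = 2m - n - |\<eta>|\<close>, the
  right-hand side \<open>1 + |ln r| + r\<^sup>s\<close> is comparable to \<open>r\<^sup>s\<close> on bounded sets when \<open>s < 0\<close>.
  When \<open>s \<ge> 0\<close> it is larger than \<open>r\<^sup>s\<close>, so that this is implied by \<open>|D\<^sup>\<eta> R(x,y)| \<le> C r\<^sup>s\<close>.
  The latter could not be required there, since the Green function violates it: for \<open>n < 2m\<close> one has
  \<open>R(y,y) > 0\<close>, so \<open>R(x,y)\<close> does not tend to \<open>0\<close> as \<open>x\<close> tends to \<open>y\<close>, and for \<open>n = 2m\<close> it has a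
  logarithmic singularity.\<close>

definition green_estimate ::
    "(real^'n::finite) set \<Rightarrow> nat \<Rightarrow> (real^'n \<Rightarrow> real^'n \<Rightarrow> real) \<Rightarrow> bool" where
  "green_estimate \<Omega> m R \<longleftrightarrow>
     (\<exists>C. \<forall>\<eta>. real (mi_order \<eta>) \<le> max_order CARD('n) m \<longrightarrow>
        (\<forall>x\<in>\<Omega>. \<forall>y\<in>\<Omega>. x \<noteq> y \<longrightarrow>
           \<bar>mderiv \<eta> (\<lambda>z. R z y) x\<bar> \<le>
             C * (1 + \<bar>ln (norm (x - y))\<bar> +
                  norm (x - y) powr (2 * real m - real CARD('n) - real (mi_order \<eta>)))))"

definition green_potential ::
    "(real^'n::finite) set \<Rightarrow> (real^'n \<Rightarrow> real^'n \<Rightarrow> real) \<Rightarrow> (real^'n \<Rightarrow> real) \<Rightarrow> real^'n \<Rightarrow> real" where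
  "green_potential \<Omega> R f x = integral\<^sup>L (lebesgue_on \<Omega>) (\<lambda>y. R x y * f y)"

end

theory Submission
  imports Defs "HOL-Computational_Algebra.Polynomial"
begin

text \<open>
The range of \<open>k\<close> is such that the derivatives \<open>D\<^sup>\<eta> R(x, y)\<close>, \<open>|\<eta>| \<le> k\<close>, are bounded by a multiple of \<open>1 / |x - y|\<close>
(lemma \<open>green_kernel_bound\<close>). Since \<open>n \<ge> 2\<close>, this kernel is integrable with room to spare, and the theorem
splits into two independent facts about such kernels.

First, the operator with kernel \<open>1 / |x - y|\<close> on a bounded set is bounded on \<open>L\<^sup>p(w)\<close>. It is dominated by the sum over
dyadic scales of \<open>2\<^sup>j\<close> times integrals over cubes of side comparable to \<open>2\<^sup>-\<^sup>j\<close>, and such an integral is \<open>2\<^sup>-\<^sup>j\<^sup>n\<close> times an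
average. Averages at one fixed scale are bounded on \<open>L\<^sup>p(w)\<close> uniformly in the scale, as an immediate
consequence of the Muckenhoupt condition, and the factors \<open>2\<^sup>j\<^sup>(\<^sup>1\<^sup>-\<^sup>n\<^sup>)\<close> are summable. This is lemma
\<open>dyadic_potential_bound\<close>.

Second, the weak derivatives of the potential are obtained by differentiating under the integral sign
(lemma \<open>potential_weak_derivative\<close>). By Fubini's theorem this reduces to the statement that the classical derivatives of
\<open>R(\<cdot>, y)\<close> off the pole are also its weak derivatives across the pole (lemma \<open>kernel_weak_derivative\<close>). Integration by
parts along lines proves this, for only one line of each direction meets the pole (lemma \<open>integral_directional_derivative_zero\<close>).

The Sobolev norm is defined by means of some choice of weak derivatives. That it can be computed from the derivatives
just found is the uniqueness of weak derivatives (lemma \<open>has_weak_deriv_unique\<close>), for which sufficiently many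
test functions are constructed from the function \<open>exp (- 1 / t)\<close>.
\<close>

section \<open>Iterated partial derivatives\<close>

lemma has_partial:
  fixes f :: "real^'n::finite \<Rightarrow> real"
  assumes "f differentiable (at x)"
  shows "((\<lambda>t. f (x + t *\<^sub>R axis i 1)) has_real_derivative partial i f x) (at 0)"
proof -
  obtain f' where f': "(f has_derivative f') (at x)"
    using assms by (auto simp: differentiable_def)
  have "((\<lambda>t::real. x + t *\<^sub>R axis i 1) has_derivative (\<lambda>t. t *\<^sub>R axis i 1)) (at 0)"
    by (auto intro!: derivative_eq_intros)
  then have "((\<lambda>t. f (x + t *\<^sub>R axis i 1)) has_derivative (\<lambda>t. f' (t *\<^sub>R axis i 1))) (at 0)"
    using has_derivative_compose[of "\<lambda>t::real. x + t *\<^sub>R axis i 1" _ 0 UNIV f f'] f' by simp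
  then have "(\<lambda>t. f (x + t *\<^sub>R axis i 1)) differentiable (at 0)"
    by (auto simp: differentiable_def)
  then have "(\<lambda>t. f (x + t *\<^sub>R axis i 1)) field_differentiable (at 0)"
    by (simp add: field_differentiable_def real_differentiable_def)
  then show ?thesis
    unfolding partial_def by (simp add: DERIV_deriv_iff_field_differentiable)
qed

lemma has_partial_line:
  fixes f :: "real^'n::finite \<Rightarrow> real"
  assumes "f differentiable (at (x + s *\<^sub>R axis i 1))"
  shows "((\<lambda>t. f (x + t *\<^sub>R axis i 1)) has_real_derivative partial i f (x + s *\<^sub>R axis i 1)) (at s)"
  using has_partial[OF assms, of i] DERIV_at_within_shift[of "\<lambda>t. f (x + t *\<^sub>R axis i 1)" _ s 0 UNIV]
  by (simp add: algebra_simps)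

lemma partial_eqI:
  "((\<lambda>t. f (x + t *\<^sub>R axis i 1)) has_real_derivative D) (at 0) \<Longrightarrow> partial i f x = D"
  unfolding partial_def by (rule DERIV_imp_deriv)

lemma eventually_line_in_open:
  fixes x :: "real^'n::finite"
  assumes "open S" "x \<in> S"
  shows "\<forall>\<^sub>F t in nhds (0::real). x + t *\<^sub>R axis i 1 \<in> S"
proof -
  have "isCont (\<lambda>t. x + t *\<^sub>R axis i 1) (0::real)"
    by (intro continuous_intros)
  then have "filterlim (\<lambda>t. x + t *\<^sub>R axis i 1) (nhds x) (nhds (0::real))"
    using tendsto_at_iff_tendsto_nhds[of "\<lambda>t. x + t *\<^sub>R axis i 1" "0::real"] by (simp add: isCont_def)
  then show ?thesis using assms by (rule topological_tendstoD)
qed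

lemma partial_local:
  fixes f g :: "real^'n::finite \<Rightarrow> real"
  assumes "open S" "x \<in> S" "\<And>z. z \<in> S \<Longrightarrow> f z = g z"
  shows "partial i f x = partial i g x"
proof -
  have "\<forall>\<^sub>F t in nhds (0::real). f (x + t *\<^sub>R axis i 1) = g (x + t *\<^sub>R axis i 1)"
    using eventually_line_in_open[OF assms(1,2)] by eventually_elim (rule assms)
  then show ?thesis unfolding partial_def by (rule deriv_cong_ev) simp
qed

lemma smooth_on_partial: "smooth_on S f \<Longrightarrow> smooth_on S (partial i f)"
  unfolding smooth_on_def
proof (intro allI ballI)
  fix js x assume *: "\<forall>is. \<forall>x\<in>S. foldr partial is f differentiable at x" and "x \<in> S"
  then show "foldr partial js (partial i f) differentiable at x"
    using *[rule_format, of x "js @ [i]"] by simp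
qed

lemma smooth_on_partials: "smooth_on S f \<Longrightarrow> smooth_on S (foldr partial is f)"
  by (induction "is") (auto intro: smooth_on_partial)

lemma smooth_on_differentiable: "smooth_on S f \<Longrightarrow> x \<in> S \<Longrightarrow> f differentiable (at x)"
  unfolding smooth_on_def by (metis foldr_Nil id_apply)

lemma smooth_on_continuous: "smooth_on S f \<Longrightarrow> continuous_on S f"
  by (meson continuous_at_imp_continuous_on differentiable_imp_continuous_within smooth_on_differentiable)

subsection \<open>Symmetry of second derivatives\<close>

text \<open>Two applications of the mean value theorem, first along \<open>i\<close> and then along \<open>j\<close>. The left-hand side is
symmetric in \<open>i\<close> and \<open>j\<close>, so the two mixed derivatives agree at points arbitrarily close to \<open>x\<close>;
letting \<open>h\<close> tend to \<open>0\<close> gives Schwarz's theorem.\<close>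

lemma second_difference:
  fixes f :: "real^'n::finite \<Rightarrow> real"
  assumes f: "smooth_on UNIV f" and h: "0 < h"
  shows "\<exists>s t. 0 < s \<and> s < h \<and> 0 < t \<and> t < h \<and>
    f (x + h *\<^sub>R axis i 1 + h *\<^sub>R axis j 1) - f (x + h *\<^sub>R axis i 1) - f (x + h *\<^sub>R axis j 1) + f x
     = h * h * partial j (partial i f) (x + s *\<^sub>R axis i 1 + t *\<^sub>R axis j 1)"
proof -
  let ?i = "axis i (1::real)" and ?j = "axis j (1::real)"
  let ?g = "\<lambda>s. f ((x + h *\<^sub>R ?j) + s *\<^sub>R ?i) - f (x + s *\<^sub>R ?i)"
  have "DERIV ?g s :> partial i f ((x + h *\<^sub>R ?j) + s *\<^sub>R ?i) - partial i f (x + s *\<^sub>R ?i)" for s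
    by (intro DERIV_diff has_partial_line smooth_on_differentiable[OF f]) auto
  then obtain s where s: "0 < s" "s < h"
    "?g h - ?g 0 = (h - 0) * (partial i f ((x + h *\<^sub>R ?j) + s *\<^sub>R ?i) - partial i f (x + s *\<^sub>R ?i))"
    using MVT2[OF h, of ?g "\<lambda>s. partial i f ((x + h *\<^sub>R ?j) + s *\<^sub>R ?i) - partial i f (x + s *\<^sub>R ?i)"] by blast
  let ?k = "\<lambda>t. partial i f ((x + s *\<^sub>R ?i) + t *\<^sub>R ?j)"
  have "DERIV ?k t :> partial j (partial i f) ((x + s *\<^sub>R ?i) + t *\<^sub>R ?j)" for t
    by (intro has_partial_line smooth_on_differentiable[OF smooth_on_partial[OF f]]) auto
  then obtain t where t: "0 < t" "t < h"
    "?k h - ?k 0 = (h - 0) * partial j (partial i f) ((x + s *\<^sub>R ?i) + t *\<^sub>R ?j)"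
    using MVT2[OF h, of ?k "\<lambda>t. partial j (partial i f) ((x + s *\<^sub>R ?i) + t *\<^sub>R ?j)"] by blast
  have "?g h - ?g 0 = h * (?k h - ?k 0)"
    using s(3) by (simp add: algebra_simps)
  then have "?g h - ?g 0 = h * h * partial j (partial i f) ((x + s *\<^sub>R ?i) + t *\<^sub>R ?j)"
    using t(3) by simp
  moreover have "?g h - ?g 0 = f (x + h *\<^sub>R ?i + h *\<^sub>R ?j) - f (x + h *\<^sub>R ?i) - f (x + h *\<^sub>R ?j) + f x"
    by (simp add: algebra_simps)
  ultimately show ?thesis using s(1,2) t(1,2) by metis
qed

lemma partial_commute:
  fixes f :: "real^'n::finite \<Rightarrow> real"
  assumes f: "smooth_on UNIV f"
  shows "partial i (partial j f) = partial j (partial i f)"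
proof
  fix x
  let ?i = "axis i (1::real)" and ?j = "axis j (1::real)"
  define h where "h n = 1 / real (Suc n)" for n
  have h0: "h n > 0" for n by (simp add: h_def)
  have hlim: "h \<longlonglongrightarrow> 0" unfolding h_def by (rule LIMSEQ_Suc[OF lim_1_over_n])
  have lim: "(\<lambda>n. g (x + s n *\<^sub>R axis a 1 + t n *\<^sub>R axis b 1)) \<longlonglongrightarrow> g x"
    if "\<And>n. 0 < s n \<and> s n < h n \<and> 0 < t n \<and> t n < h n" "smooth_on UNIV g"
    for s t :: "nat \<Rightarrow> real" and g :: "real^'n \<Rightarrow> real" and a b
  proof -
    have "s \<longlonglongrightarrow> 0" "t \<longlonglongrightarrow> 0"
      using that(1) by (auto intro!: tendsto_sandwich[OF _ _ tendsto_const hlim] always_eventually less_imp_le)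
    then have "(\<lambda>n. x + s n *\<^sub>R axis a 1 + t n *\<^sub>R axis b 1) \<longlonglongrightarrow> x + 0 *\<^sub>R axis a 1 + 0 *\<^sub>R axis b 1"
      by (intro tendsto_intros)
    moreover have "isCont g x"
      using smooth_on_continuous[OF that(2)] by (simp add: continuous_on_eq_continuous_at)
    ultimately show ?thesis using isCont_tendsto_compose[of x g] by simp
  qed
  let ?D = "\<lambda>n. f (x + h n *\<^sub>R ?i + h n *\<^sub>R ?j) - f (x + h n *\<^sub>R ?i) - f (x + h n *\<^sub>R ?j) + f x"
  have "\<exists>s t. 0 < s \<and> s < h n \<and> 0 < t \<and> t < h n \<and>
     ?D n = h n * h n * partial j (partial i f) (x + s *\<^sub>R ?i + t *\<^sub>R ?j)" for n
    by (rule second_difference[OF f h0])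
  then obtain s t where 1: "\<And>n. 0 < s n \<and> s n < h n \<and> 0 < t n \<and> t n < h n"
    "\<And>n. ?D n = h n * h n * partial j (partial i f) (x + s n *\<^sub>R ?i + t n *\<^sub>R ?j)" by metis
  have "\<exists>s t. 0 < s \<and> s < h n \<and> 0 < t \<and> t < h n \<and>
     ?D n = h n * h n * partial i (partial j f) (x + s *\<^sub>R ?j + t *\<^sub>R ?i)" for n
    using second_difference[OF f h0, of n x j i] by (simp add: algebra_simps)
  then obtain s' t' where 2: "\<And>n. 0 < s' n \<and> s' n < h n \<and> 0 < t' n \<and> t' n < h n"
    "\<And>n. ?D n = h n * h n * partial i (partial j f) (x + s' n *\<^sub>R ?j + t' n *\<^sub>R ?i)" by metis
  have "partial j (partial i f) (x + s n *\<^sub>R ?i + t n *\<^sub>R ?j)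
      = partial i (partial j f) (x + s' n *\<^sub>R ?j + t' n *\<^sub>R ?i)" for n
    using 1(2)[of n] 2(2)[of n] h0[of n] by simp
  then have "(\<lambda>n. partial i (partial j f) (x + s' n *\<^sub>R ?j + t' n *\<^sub>R ?i)) \<longlonglongrightarrow> partial j (partial i f) x"
    using lim[OF 1(1), of "partial j (partial i f)" i j] f by (simp add: smooth_on_partial)
  moreover have "(\<lambda>n. partial i (partial j f) (x + s' n *\<^sub>R ?j + t' n *\<^sub>R ?i)) \<longlonglongrightarrow> partial i (partial j f) x"
    using lim[OF 2(1), of "partial i (partial j f)" j i] f by (simp add: smooth_on_partial)
  ultimately show "partial i (partial j f) x = partial j (partial i f) x"
    using LIMSEQ_unique by blast
qed

lemma partial_foldr_commute:
  assumes "smooth_on UNIV f"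
  shows "partial i (foldr partial is f) = foldr partial is (partial i f)"
proof (induction "is")
  case (Cons j js)
  then show ?case
    using partial_commute[OF smooth_on_partials[OF assms, of js], of i j] by simp
qed simp

subsection \<open>Multi-indices\<close>

text \<open>The derivative of a multi-index is an iterated derivative along a list of coordinates. In this form the outermost
derivative can be split off, and what remains again belongs to a multi-index.\<close>

definition mi_list :: "('n::finite \<Rightarrow> nat) \<Rightarrow> 'n list \<Rightarrow> 'n list" where
  "mi_list \<eta> L = concat (map (\<lambda>i. replicate (\<eta> i) i) L)"

lemma foldr_replicate_power: "foldr g (replicate k i) f = (g i ^^ k) f"
  by (induction k) auto

lemma mderiv_conv_foldr: "mderiv \<eta> f = foldr partial (mi_list \<eta> coords) f"
proof -
  have "foldr (\<lambda>i g. (partial i ^^ \<eta> i) g) L f = foldr partial (mi_list \<eta> L) f" for L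
    by (induction L) (auto simp: mi_list_def foldr_replicate_power)
  then show ?thesis by (simp add: mderiv_def)
qed

lemma coords: "distinct (coords :: 'n::finite list)" "set (coords :: 'n list) = UNIV"
  using someI_ex[OF finite_distinct_list[of "UNIV :: 'n set"]] unfolding coords_def
  by (auto simp: conj_commute)

lemma mi_list_decrement:
  assumes "distinct L" "mi_list \<eta> L = i # s"
  shows "i \<in> set L \<and> 0 < \<eta> i \<and> s = mi_list (\<eta>(i := \<eta> i - 1)) L"
  using assms
proof (induction L)
  case (Cons a L)
  have eq: "mi_list (\<eta>(b := c)) L = mi_list \<eta> L" if "b \<notin> set L" for b c
    using that by (auto simp: mi_list_def intro!: arg_cong[where f=concat])
  show ?case
  proof (cases "\<eta> a")
    case 0
    then show ?thesis using Cons by (auto simp: mi_list_def)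
  next
    case (Suc k)
    then have "i = a" "s = replicate k a @ mi_list \<eta> L" using Cons.prems by (auto simp: mi_list_def)
    moreover have "mi_list (\<eta>(a := k)) L = mi_list \<eta> L" using Cons.prems by (intro eq) simp
    ultimately show ?thesis using Suc by (simp add: mi_list_def)
  qed
qed (simp add: mi_list_def)

text \<open>The rule for induction on the order. The decomposition does not depend on \<open>f\<close>, so that in an integration by
parts it splits the derivatives of the kernel and of the test function in the same way.\<close>

lemma mderiv_cases:
  fixes \<eta> :: "'n::finite \<Rightarrow> nat"
  obtains "mi_order \<eta> = 0" "\<And>f. mderiv \<eta> f = f"
  | i \<eta>' where "mi_order \<eta> = Suc (mi_order \<eta>')" "\<And>f. mderiv \<eta> f = partial i (mderiv \<eta>' f)"
proof (cases "mi_list \<eta> coords")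
  case Nil
  then have "\<eta> i = 0" for i
    using coords(2) by (auto simp: mi_list_def)
  then show ?thesis using that(1) Nil by (auto simp: mi_order_def mderiv_conv_foldr)
next
  case (Cons i s)
  note * = mi_list_decrement[OF coords(1) Cons]
  have "mi_order \<eta> = Suc (mi_order (\<eta>(i := \<eta> i - 1)))"
    unfolding mi_order_def using *
    by (subst (1 2) sum.remove[of _ i]) (auto intro!: sum.cong)
  then show ?thesis
    using that(2)[of "\<eta>(i := \<eta> i - 1)" i] Cons * by (simp add: mderiv_conv_foldr)
qed

text \<open>Each integration by parts takes the outermost derivative off the test function and makes it the outermost one
of the kernel, which reverses the order of differentiation. Symmetry restores the order; it is applied to the test
function, which is smooth everywhere.\<close>

lemma partial_mderiv_commute:
  "smooth_on UNIV f \<Longrightarrow> partial i (mderiv \<eta> f) = mderiv \<eta> (partial i f)"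
  by (simp add: mderiv_conv_foldr partial_foldr_commute)

lemma smooth_on_mderiv: "smooth_on S f \<Longrightarrow> smooth_on S (mderiv \<eta> f)"
  by (simp add: mderiv_conv_foldr smooth_on_partials)

subsection \<open>Test functions\<close>

lemma partial_outside_support:
  assumes "x \<notin> closure {x. \<phi> x \<noteq> 0}"
  shows "partial i \<phi> x = 0"
proof -
  have "partial i \<phi> x = partial i (\<lambda>_. 0) x"
  proof (rule partial_local)
    show "open (- closure {x. \<phi> x \<noteq> 0})" by (rule open_Compl) (rule closed_closure)
    show "x \<in> - closure {x. \<phi> x \<noteq> 0}" using assms by simp
    show "\<phi> z = 0" if "z \<in> - closure {x. \<phi> x \<noteq> 0}" for z
      using that closure_subset[of "{x. \<phi> x \<noteq> 0}"] by auto
  qed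
  also have "\<dots> = 0" unfolding partial_def by simp
  finally show ?thesis .
qed

lemma test_functions_partial:
  assumes "\<phi> \<in> test_functions \<Omega>"
  shows "partial i \<phi> \<in> test_functions \<Omega>"
proof -
  have "{x. partial i \<phi> x \<noteq> 0} \<subseteq> closure {x. \<phi> x \<noteq> 0}"
    using partial_outside_support by blast
  then have "closure {x. partial i \<phi> x \<noteq> 0} \<subseteq> closure {x. \<phi> x \<noteq> 0}"
    by (simp add: closure_minimal)
  then show ?thesis using assms smooth_on_partial unfolding test_functions_def
    using closed_Int_compact[OF closed_closure, of "closure {x. \<phi> x \<noteq> 0}" "{x. partial i \<phi> x \<noteq> 0}"]
    by (auto simp: inf.absorb1)
qed

lemma test_functions_mderiv:
  assumes "\<phi> \<in> test_functions \<Omega>"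
  shows "mderiv \<eta> \<phi> \<in> test_functions \<Omega>"
proof -
  have "foldr partial is \<phi> \<in> test_functions \<Omega>" for "is"
    by (induction "is") (auto intro: assms test_functions_partial)
  then show ?thesis by (simp add: mderiv_conv_foldr)
qed

lemma test_functions_smooth: "\<phi> \<in> test_functions \<Omega> \<Longrightarrow> smooth_on UNIV \<phi>"
  by (simp add: test_functions_def)

lemma test_functions_bounded:
  assumes "\<phi> \<in> test_functions \<Omega>"
  obtains M where "0 \<le> M" "\<And>x. \<bar>\<phi> x\<bar> \<le> M"
proof -
  let ?K = "closure {x. \<phi> x \<noteq> 0}"
  have "continuous_on ?K \<phi>"
    using smooth_on_continuous[OF test_functions_smooth[OF assms]] continuous_on_subset by blast
  then have "bounded (\<phi> ` ?K)"
    using assms by (intro compact_imp_bounded compact_continuous_image) (auto simp: test_functions_def)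
  then obtain M where M: "0 < M" "\<And>x. x \<in> ?K \<Longrightarrow> \<bar>\<phi> x\<bar> \<le> M"
    by (auto simp: bounded_pos)
  have "\<bar>\<phi> x\<bar> \<le> M" for x
    using M closure_subset[of "{x. \<phi> x \<noteq> 0}"] by (cases "\<phi> x = 0") auto
  then show ?thesis using M(1) that[of M] by auto
qed

lemma test_functions_measurable:
  "\<phi> \<in> test_functions \<Omega> \<Longrightarrow> \<phi> \<in> borel_measurable borel"
  by (meson borel_measurable_continuous_onI smooth_on_continuous test_functions_smooth)

section \<open>Uniqueness of weak derivatives\<close>

text \<open>For \<open>p = 1\<close> this is the classical smooth flat function. The polynomial factor in \<open>1 / t\<close> makes the family
closed under differentiation.\<close>

definition flat_exp :: "real poly \<Rightarrow> real \<Rightarrow> real" where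
  "flat_exp p t = (if 0 < t then poly p (1 / t) * exp (- (1 / t)) else 0)"

lemma poly_exp_decay: "((\<lambda>u. poly p u * exp (- u)) \<longlongrightarrow> (0::real)) at_top"
proof -
  have "((\<lambda>u. \<Sum>i\<le>degree p. coeff p i * (u ^ i / exp u)) \<longlongrightarrow> (\<Sum>i\<le>degree p. coeff p i * 0)) at_top"
    by (intro tendsto_intros tendsto_power_div_exp_0)
  then show ?thesis
    by (simp add: poly_altdef exp_minus sum_distrib_right divide_inverse mult.assoc)
qed

lemma flat_exp_deriv:
  "(flat_exp p has_real_derivative flat_exp ([:0,0,1:] * (p - pderiv p)) t) (at t)"
proof -
  consider "t > 0" | "t < 0" | "t = 0" by linarith
  then show ?thesis
  proof cases
    case 1
    have "((\<lambda>t. poly p (1 / t) * exp (- (1 / t))) has_real_derivative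
        poly ([:0,0,1:] * (p - pderiv p)) (1 / t) * exp (- (1 / t))) (at t)"
      using 1 by (auto intro!: derivative_eq_intros simp: field_simps power2_eq_square)
    moreover have "eventually (\<lambda>x. x \<in> {0<..}) (nhds t)"
      using 1 by (intro eventually_nhds_in_open) auto
    then have "eventually (\<lambda>x. flat_exp p x = poly p (1 / x) * exp (- (1 / x))) (nhds t)"
      by eventually_elim (simp add: flat_exp_def)
    ultimately show ?thesis
      using 1 DERIV_cong_ev[of t t "flat_exp p"] by (simp add: flat_exp_def)
  next
    case 2
    have "eventually (\<lambda>x. x \<in> {..<0}) (nhds t)"
      using 2 by (intro eventually_nhds_in_open) auto
    then have "eventually (\<lambda>x. flat_exp p x = 0) (nhds t)"
      by eventually_elim (simp add: flat_exp_def)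
    then show ?thesis
      using 2 DERIV_cong_ev[of t t "flat_exp p" "\<lambda>_. 0"] by (simp add: flat_exp_def)
  next
    case 3
    have "((\<lambda>h. poly ([:0,1:] * p) (1 / h) * exp (- (1 / h))) \<longlongrightarrow> 0) (at_right (0::real))"
      using poly_exp_decay[of "[:0,1:] * p"]
      by (subst (asm) filterlim_at_top_to_right) (simp add: field_simps)
    then have r: "((\<lambda>h. flat_exp p h / h) \<longlongrightarrow> 0) (at_right 0)"
      by (rule Lim_transform_eventually) (auto simp: eventually_at_filter flat_exp_def)
    have l: "((\<lambda>h. flat_exp p h / h) \<longlongrightarrow> 0) (at_left 0)"
      by (rule tendsto_eventually) (auto simp: eventually_at_filter flat_exp_def)
    have "((\<lambda>h. flat_exp p h / h) \<longlongrightarrow> 0) (at 0)"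
      using l r by (simp add: filterlim_split_at)
    then show ?thesis using 3 by (simp add: has_field_derivative_iff flat_exp_def)
  qed
qed

text \<open>A class of functions that contains products of flat functions of the coordinates and is closed under
partial derivatives; membership therefore implies smoothness.\<close>

inductive_set bumps :: "(real^'n::finite \<Rightarrow> real) set" where
  base: "(\<lambda>x. flat_exp p (c * x $ i + d)) \<in> bumps"
| const: "(\<lambda>x. c) \<in> bumps"
| add: "f \<in> bumps \<Longrightarrow> g \<in> bumps \<Longrightarrow> (\<lambda>x. f x + g x) \<in> bumps"
| mult: "f \<in> bumps \<Longrightarrow> g \<in> bumps \<Longrightarrow> (\<lambda>x. f x * g x) \<in> bumps"

lemma bumps_differentiable: "f \<in> bumps \<Longrightarrow> f differentiable (at x)"
proof (induction rule: bumps.induct)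
  case (base p c i d)
  have "((\<lambda>x. c * x $ i + d) has_derivative (\<lambda>h. c * h $ i)) (at x)"
    by (auto intro!: derivative_eq_intros bounded_linear_imp_has_derivative)
  then have "((\<lambda>x. flat_exp p (c * x $ i + d)) has_derivative
      (\<lambda>h. flat_exp ([:0,0,1:] * (p - pderiv p)) (c * x $ i + d) * (c * h $ i))) (at x)"
    using has_derivative_compose flat_exp_deriv[of p "c * x $ i + d", unfolded has_field_derivative_def] by blast
  then show ?case by (auto simp: differentiable_def)
qed (auto intro: differentiable_add differentiable_mult)

lemma bumps_partial:
  fixes f :: "real^'n::finite \<Rightarrow> real"
  shows "f \<in> bumps \<Longrightarrow> partial j f \<in> bumps"
proof (induction rule: bumps.induct)
  case (base p c i d)
  let ?q = "[:0,0,1:] * (p - pderiv p)"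
  have "((\<lambda>t. flat_exp p (c * (x + t *\<^sub>R axis j 1) $ i + d)) has_real_derivative
     flat_exp ?q (c * x $ i + d) * (c * axis j 1 $ i)) (at 0)" for x :: "real^'n"
  proof (rule DERIV_chain2[where g = "\<lambda>t. c * (x + t *\<^sub>R axis j 1) $ i + d" and f = "flat_exp p"])
    show "(flat_exp p has_real_derivative flat_exp ?q (c * x $ i + d)) (at (c * (x + 0 *\<^sub>R axis j 1) $ i + d))"
      using flat_exp_deriv[of p "c * x $ i + d"] by simp
    show "((\<lambda>t. c * (x + t *\<^sub>R axis j 1) $ i + d) has_real_derivative c * axis j 1 $ i) (at 0)"
      by (auto intro!: derivative_eq_intros)
  qed
  then have "partial j (\<lambda>x. flat_exp p (c * x $ i + d)) = (\<lambda>x. flat_exp ?q (c * x $ i + d) * (c * axis j 1 $ i))"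
    by (intro ext partial_eqI)
  then show ?case by (auto intro!: bumps.intros(2-) bumps.base)
next
  case (const c)
  have "partial j (\<lambda>x. c) = (\<lambda>x. 0)" by (intro ext partial_eqI) simp
  then show ?case by (simp add: bumps.const)
next
  case (add f g)
  have "partial j (\<lambda>x. f x + g x) = (\<lambda>x. partial j f x + partial j g x)"
    by (intro ext partial_eqI DERIV_add has_partial bumps_differentiable add)
  then show ?case by (simp add: add bumps.add)
next
  case (mult f g)
  have "((\<lambda>t. f (x + t *\<^sub>R axis j 1) * g (x + t *\<^sub>R axis j 1)) has_real_derivative
      partial j f x * g x + partial j g x * f x) (at 0)" for x
    using DERIV_mult[OF has_partial[OF bumps_differentiable[OF mult(1)]] has_partial[OF bumps_differentiable[OF mult(2)]], of x j x j]
    by simp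
  then have "partial j (\<lambda>x. f x * g x) = (\<lambda>x. partial j f x * g x + partial j g x * f x)"
    by (intro ext partial_eqI)
  then show ?case by (simp add: mult bumps.add bumps.mult)
qed

lemma bumps_smooth: assumes "f \<in> bumps" shows "smooth_on UNIV f"
proof -
  have "foldr partial is f \<in> bumps" for "is"
    by (induction "is") (auto intro: assms bumps_partial)
  then show ?thesis by (simp add: smooth_on_def bumps_differentiable)
qed

lemma bumps_prod: "(\<And>i. i \<in> A \<Longrightarrow> f i \<in> bumps) \<Longrightarrow> (\<lambda>x. \<Prod>i\<in>A. f i x) \<in> bumps"
  by (induction A rule: infinite_finite_induct) (auto intro: bumps.intros)

text \<open>Since \<open>exp (- 1 / (N t))\<close> increases to \<open>1\<close> for every \<open>t > 0\<close>, speeding up the flat function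
by a factor \<open>N\<close> in each coordinate gives test functions that converge boundedly to the indicator of the open
box.\<close>

lemma box_bumps_exist:
  fixes a b :: "real^'n::finite"
  assumes "cbox a b \<subseteq> \<Omega>"
  obtains \<phi> where "\<And>n::nat. \<phi> n \<in> test_functions \<Omega>"
    "\<And>n x. \<bar>\<phi> n x\<bar> \<le> indicator (box a b) x"
    "\<And>x. (\<lambda>n. \<phi> n x) \<longlonglongrightarrow> indicator (box a b) x"
proof -
  define \<phi> where "\<phi> n x = (\<Prod>i\<in>UNIV. flat_exp 1 (Suc n * x $ i + - (Suc n * a $ i)) *
     flat_exp 1 (- Suc n * x $ i + Suc n * b $ i))" for n :: nat and x :: "real^'n"
  have fe: "0 \<le> flat_exp 1 t" "flat_exp 1 t \<le> 1" for t by (auto simp: flat_exp_def)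
  have bx: "x \<in> box a b \<longleftrightarrow> (\<forall>i. a $ i < x $ i \<and> x $ i < b $ i)" for x by (rule mem_box_cart)
  have zero: "\<phi> n x = 0" if x: "x \<notin> box a b" for n x
  proof -
    obtain i where "x $ i \<le> a $ i \<or> b $ i \<le> x $ i" using x by (auto simp: bx not_less)
    then have "flat_exp 1 (Suc n * x $ i + - (Suc n * a $ i)) *
       flat_exp 1 (- Suc n * x $ i + Suc n * b $ i) = 0"
      using mult_left_mono[of "x $ i" "a $ i" "real (Suc n)"] mult_left_mono[of "b $ i" "x $ i" "real (Suc n)"]
      by (auto simp: flat_exp_def algebra_simps)
    then show ?thesis unfolding \<phi>_def by (intro prod_zero) auto
  qed
  have "smooth_on UNIV (\<phi> n)" for n
    unfolding \<phi>_def by (intro bumps_smooth bumps_prod bumps.mult bumps.base)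
  moreover have sub: "closure {x. \<phi> n x \<noteq> 0} \<subseteq> cbox a b" for n
  proof (rule closure_minimal)
    show "{x. \<phi> n x \<noteq> 0} \<subseteq> cbox a b"
      using zero[of _ n] box_subset_cbox[of a b] by blast
  qed (rule closed_cbox)
  moreover have "compact (closure {x. \<phi> n x \<noteq> 0})" for n
    using sub[of n] by (metis bounded_cbox bounded_subset compact_eq_bounded_closed closed_closure)
  ultimately have test: "\<phi> n \<in> test_functions \<Omega>" for n
    using assms by (simp add: test_functions_def) (meson order_trans)
  have nonneg: "0 \<le> \<phi> n x" for n x
    unfolding \<phi>_def by (intro prod_nonneg) (auto simp: fe)
  have le1: "\<phi> n x \<le> 1" for n x
    unfolding \<phi>_def by (intro prod_le_1) (auto simp: fe intro!: mult_le_one)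
  have bound: "\<bar>\<phi> n x\<bar> \<le> indicator (box a b) x" for n x
    using zero[of x n] le1[of n x] nonneg[of n x] by (auto simp: indicator_def)
  have lim1: "(\<lambda>n. flat_exp 1 (real (Suc n) * t)) \<longlonglongrightarrow> 1" if "t > 0" for t :: real
  proof -
    have "(\<lambda>n. exp (- (1 / t * (1 / Suc n)))) \<longlonglongrightarrow> exp (- (1 / t * 0))"
      using LIMSEQ_Suc[OF lim_1_over_n] by (intro tendsto_intros) simp
    moreover have "flat_exp 1 (real (Suc n) * t) = exp (- (1 / t * (1 / Suc n)))" for n
    proof -
      have "0 < real (Suc n) * t" using that by simp
      then show ?thesis unfolding flat_exp_def by (simp del: of_nat_Suc)
    qed
    ultimately show ?thesis by simp
  qed
  have "(\<lambda>n. \<phi> n x) \<longlonglongrightarrow> indicator (box a b) x" for x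
  proof (cases "x \<in> box a b")
    case True
    have "(\<lambda>n. \<Prod>i\<in>UNIV. flat_exp 1 (real (Suc n) * (x $ i - a $ i)) * flat_exp 1 (real (Suc n) * (b $ i - x $ i)))
       \<longlonglongrightarrow> (\<Prod>i\<in>(UNIV::'n set). 1 * 1)"
      using True by (intro tendsto_prod tendsto_mult lim1) (auto simp: bx)
    then show ?thesis using True unfolding \<phi>_def by (simp add: algebra_simps)
  qed (simp add: zero)
  then show ?thesis using that test bound by blast
qed

text \<open>The positive and the negative part of \<open>h\<close> are densities of two measures that agree on the intersection-stable
generator formed by the boxes, hence everywhere.\<close>

lemma AE_zero_if_box_integrals_zero:
  fixes h :: "real^'n::finite \<Rightarrow> real"
  assumes h: "integrable lborel h"
    and zero: "\<And>a b. integral\<^sup>L lborel (\<lambda>x. indicator (box a b) x * h x) = 0"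
  shows "AE x in lborel. h x = 0"
proof -
  have [measurable]: "h \<in> borel_measurable borel" using h by auto
  let ?P = "density lborel (\<lambda>x. ennreal (h x))" and ?N = "density lborel (\<lambda>x. ennreal (- h x))"
  have eq: "emeasure ?P (box a b) = emeasure ?N (box a b)"
    and fin: "emeasure ?P (box a b) \<noteq> \<infinity>" for a b
  proof -
    let ?g = "\<lambda>x. indicator (box a b) x * h x"
    have g: "integrable lborel ?g"
      using integrable_mult_indicator[OF _ h, of "box a b"] by simp
    have P: "emeasure ?P (box a b) = (\<integral>\<^sup>+x. ennreal (?g x) \<partial>lborel)"
      by (auto simp: emeasure_density intro!: nn_integral_cong split: split_indicator)
    have N: "emeasure ?N (box a b) = (\<integral>\<^sup>+x. ennreal (- ?g x) \<partial>lborel)"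
      by (auto simp: emeasure_density intro!: nn_integral_cong split: split_indicator)
    have f: "(\<integral>\<^sup>+x. ennreal (?g x) \<partial>lborel) \<noteq> \<infinity>" "(\<integral>\<^sup>+x. ennreal (- ?g x) \<partial>lborel) \<noteq> \<infinity>"
      using g by (auto simp: real_integrable_def)
    have "enn2real (\<integral>\<^sup>+x. ennreal (?g x) \<partial>lborel) = enn2real (\<integral>\<^sup>+x. ennreal (- ?g x) \<partial>lborel)"
      using zero[of a b] real_lebesgue_integral_def[OF g] by simp
    from arg_cong[where f=ennreal, OF this]
    have "(\<integral>\<^sup>+x. ennreal (?g x) \<partial>lborel) = (\<integral>\<^sup>+x. ennreal (- ?g x) \<partial>lborel)"
      by (simp only: f(1)[unfolded infinity_ennreal_def less_top, THEN ennreal_enn2real]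
          f(2)[unfolded infinity_ennreal_def less_top, THEN ennreal_enn2real])
    then show "emeasure ?P (box a b) = emeasure ?N (box a b)" "emeasure ?P (box a b) \<noteq> \<infinity>"
      unfolding P N using f by simp_all
  qed
  have "?P = ?N"
  proof (rule measure_eqI_generator_eq[where E="range (\<lambda>(a, b). box a b)" and \<Omega>=UNIV
        and A="\<lambda>n::nat. box (- (real n *\<^sub>R One)) (real n *\<^sub>R One)"])
    show "Int_stable (range (\<lambda>(a, b). box a b :: (real^'n) set))"
      by (auto simp: Int_stable_def box_Int_box)
    show "sets ?P = sigma_sets UNIV (range (\<lambda>(a, b). box a b))"
      "sets ?N = sigma_sets UNIV (range (\<lambda>(a, b). box a b))"
      by (simp_all add: borel_eq_box)
    show "(\<Union>n::nat. box (- (real n *\<^sub>R One)) (real n *\<^sub>R One)) = (UNIV :: (real^'n) set)"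
      by (rule UN_box_eq_UNIV)
  qed (use eq fin in auto)
  then have "AE x in lborel. ennreal (h x) = ennreal (- h x)"
    using sigma_finite_measure.density_unique_iff[OF sigma_finite_lborel, of "\<lambda>x. ennreal (h x)" "\<lambda>x. ennreal (- h x)"] by simp
  then show ?thesis
  proof eventually_elim
    case (elim x) then show ?case by (cases "0 \<le> h x") (auto simp: ennreal_neg)
  qed
qed

text \<open>The fundamental lemma of the calculus of variations. Dominated convergence along the approximations of
a box turns the hypothesis into vanishing integrals over boxes. The dominating function is \<open>\<bar>h\<bar>\<close> on
the closed box, which is why only boxes whose closure lies in \<open>\<Omega>\<close> are considered.\<close>

lemma AE_zero_if_test_integrals_zero:
  fixes h :: "real^'n::finite \<Rightarrow> real"
  assumes "open \<Omega>" and h: "locally_integrable \<Omega> h"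
    and zero: "\<And>\<phi>. \<phi> \<in> test_functions \<Omega> \<Longrightarrow> integral\<^sup>L (lebesgue_on \<Omega>) (\<lambda>x. h x * \<phi> x) = 0"
  shows "AE x in lebesgue_on \<Omega>. h x = 0"
proof -
  have \<Omega>: "\<Omega> \<in> sets lebesgue" using assms(1) by auto
  have int: "integrable lebesgue (\<lambda>x. indicator (cbox a b) x * h x)" if "cbox a b \<subseteq> \<Omega>" for a b
    using h that integrable_restrict_space[of "cbox a b" lebesgue h]
    unfolding locally_integrable_def by (auto simp: compact_cbox)
  have box0: "integral\<^sup>L lebesgue (\<lambda>x. indicator (box a b) x * h x) = 0" if ab: "cbox a b \<subseteq> \<Omega>" for a b
  proof -
    obtain \<phi> where \<phi>: "\<And>n::nat. \<phi> n \<in> test_functions \<Omega>"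
      "\<And>n x. \<bar>\<phi> n x\<bar> \<le> indicator (box a b) x"
      "\<And>x. (\<lambda>n. \<phi> n x) \<longlonglongrightarrow> indicator (box a b) x" using box_bumps_exist[OF ab] by metis
    have hc: "(\<lambda>x. indicator (cbox a b) x * h x) \<in> borel_measurable lebesgue"
      using int[OF ab] by auto
    have eq: "indicator (box a b) x * h x = indicator (box a b) x * (indicator (cbox a b) x * h x)"
      "\<phi> n x * (indicator (cbox a b) x * h x) = indicator \<Omega> x * (h x * \<phi> n x)" for n x
      using ab box_subset_cbox[of a b] \<phi>(2)[of n x]
      by (cases "x \<in> box a b"; cases "x \<in> cbox a b"; auto simp: indicator_def)+
    have "(\<lambda>n. integral\<^sup>L lebesgue (\<lambda>x. \<phi> n x * (indicator (cbox a b) x * h x))) \<longlonglongrightarrow>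
        integral\<^sup>L lebesgue (\<lambda>x. indicator (box a b) x * (indicator (cbox a b) x * h x))"
    proof (rule integral_dominated_convergence)
      show "integrable lebesgue (\<lambda>x. \<bar>indicator (cbox a b) x * h x\<bar>)" using int[OF ab] by (rule integrable_abs)
      show "(\<lambda>x. indicator (box a b) x * (indicator (cbox a b) x * h x)) \<in> borel_measurable lebesgue"
        by (rule borel_measurable_times[OF _ hc]) (auto intro: borel_measurable_indicator)
      show "(\<lambda>x. \<phi> n x * (indicator (cbox a b) x * h x)) \<in> borel_measurable lebesgue" for n
        by (rule borel_measurable_times[OF measurable_completion hc])
           (use test_functions_measurable[OF \<phi>(1)] in simp)
      show "AE x in lebesgue. (\<lambda>n. \<phi> n x * (indicator (cbox a b) x * h x)) \<longlonglongrightarrow>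
          indicator (box a b) x * (indicator (cbox a b) x * h x)"
        by (intro AE_I2 tendsto_mult[OF \<phi>(3) tendsto_const])
      have "\<bar>\<phi> n x\<bar> \<le> 1" for n x
        using \<phi>(2)[of n x] by (cases "x \<in> box a b") auto
      then show "AE x in lebesgue. norm (\<phi> n x * (indicator (cbox a b) x * h x)) \<le> \<bar>indicator (cbox a b) x * h x\<bar>" for n
        by (intro AE_I2) (auto simp: abs_mult intro: mult_left_le_one_le)
    qed
    moreover have "integral\<^sup>L lebesgue (\<lambda>x. \<phi> n x * (indicator (cbox a b) x * h x)) = 0" for n
      using zero[OF \<phi>(1)[of n]] \<Omega> unfolding eq(2) by (simp add: integral_restrict_space)
    ultimately show ?thesis
      unfolding eq(1)[symmetric] by (simp add: LIMSEQ_const_iff)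
  qed
  have cb: "AE x in lebesgue. x \<in> box a b \<longrightarrow> h x = 0" if ab: "cbox a b \<subseteq> \<Omega>" for a b
  proof -
    let ?H = "\<lambda>x. indicator (box a b) x * h x"
    have "?H = (\<lambda>x. indicator (box a b) x *\<^sub>R (indicator (cbox a b) x * h x))"
      using box_subset_cbox[of a b] by (intro ext) (auto simp: indicator_def)
    then have H: "integrable lebesgue ?H"
      using integrable_mult_indicator[OF _ int[OF ab], of "box a b"] by simp
    then have "?H \<in> borel_measurable lebesgue" by auto
    then obtain g where g[measurable]: "g \<in> borel_measurable lborel" and gH: "AE x in lborel. ?H x = g x"
      using completion_ex_borel_measurable_real by blast
    have gH': "AE x in lebesgue. ?H x = g x" using gH by (rule AE_completion)
    have "integrable lebesgue g"
      by (rule integrable_cong_AE_imp[OF H measurable_completion[OF g]]) (use gH' in eventually_elim, simp)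
    then have "integrable lborel g" using integrable_completion[OF g] by simp
    moreover have "integral\<^sup>L lborel (\<lambda>x. indicator (box c d) x * g x) = 0" for c d
    proof -
      obtain u v where uv: "box c d \<inter> box a b = box u v" "box u v = {} \<or> cbox u v \<subseteq> cbox a b"
      proof -
        let ?u = "(\<chi> i. max (c $ i) (a $ i))" and ?v = "(\<chi> i. min (d $ i) (b $ i))"
        have "box c d \<inter> box a b = box ?u ?v" by (auto simp: mem_box_cart)
        moreover have "cbox ?u ?v \<subseteq> cbox a b" by (auto simp: mem_box_cart)
        ultimately show ?thesis using that by blast
      qed
      have "integral\<^sup>L lborel (\<lambda>x. indicator (box c d) x * g x) = integral\<^sup>L lebesgue (\<lambda>x. indicator (box c d) x * g x)"
        by (rule integral_completion[symmetric]) measurable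
      also have "\<dots> = integral\<^sup>L lebesgue (\<lambda>x. indicator (box c d) x * ?H x)"
      proof (rule integral_cong_AE)
        show "AE x in lebesgue. indicator (box c d) x * g x = indicator (box c d) x * ?H x"
          using gH' by eventually_elim auto
        show "(\<lambda>x. indicator (box c d) x * g x) \<in> borel_measurable lebesgue"
          by (rule measurable_completion) measurable
        show "(\<lambda>x. indicator (box c d) x * ?H x) \<in> borel_measurable lebesgue"
          by (rule borel_measurable_times[OF measurable_completion borel_measurable_integrable[OF H]]) measurable
      qed
      also have "\<dots> = integral\<^sup>L lebesgue (\<lambda>x. indicator (box u v) x * h x)"
        unfolding uv(1)[symmetric] by (intro Bochner_Integration.integral_cong) (auto simp: indicator_def)
      also have "\<dots> = 0"
        using uv(2)
      proof
        assume "cbox u v \<subseteq> cbox a b"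
        then show ?thesis using ab by (intro box0) simp
      qed simp
      finally show ?thesis .
    qed
    ultimately have "AE x in lborel. g x = 0"
      by (rule AE_zero_if_box_integrals_zero)
    then have "AE x in lebesgue. g x = 0" by (rule AE_completion)
    with gH' show ?thesis by eventually_elim (auto simp: indicator_def)
  qed
  (* An open set is a countable union of closed boxes, so the null boundary of a box has to be added. *)
  have cc: "AE x in lebesgue. x \<in> cbox a b \<longrightarrow> h x = 0" if "cbox a b \<subseteq> \<Omega>" for a b
  proof -
    have "AE x in lebesgue. x \<notin> cbox a b - box a b"
      using negligible_frontier_interval[of a b] by (intro AE_not_in) (simp add: negligible_iff_null_sets)
    with cb[OF that] show ?thesis by eventually_elim auto
  qed
  have "\<exists>D. countable D \<and> D \<subseteq> Pow \<Omega> \<and> (\<forall>X\<in>D. \<exists>a b. X = cbox a b) \<and> \<Union>D = \<Omega>"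
  proof (rule open_countable_Union_open_cbox[OF assms(1)])
    fix D :: "(real^'n) set set"
    assume "countable D" "D \<subseteq> Pow \<Omega>" "\<And>X. X \<in> D \<Longrightarrow> \<exists>a b. X = cbox a b" "\<Union>D = \<Omega>"
    then show ?thesis by (intro exI[of _ D] conjI ballI)
  qed
  then obtain D where "countable D \<and> D \<subseteq> Pow \<Omega> \<and> (\<forall>X\<in>D. \<exists>a b. X = cbox a b) \<and> \<Union>D = \<Omega>" ..
  then have D: "countable D" "D \<subseteq> Pow \<Omega>" "\<forall>X\<in>D. \<exists>a b. X = cbox a b" "\<Union>D = \<Omega>"
    by simp_all
  have "AE x in lebesgue. x \<in> X \<longrightarrow> h x = 0" if X: "X \<in> D" for X
  proof -
    obtain a b where "X = cbox a b" using D(3) X by blast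
    moreover have "X \<subseteq> \<Omega>" using D(2) X by blast
    ultimately show ?thesis using cc by simp
  qed
  then have "AE x in lebesgue. \<forall>X\<in>D. x \<in> X \<longrightarrow> h x = 0"
    by (intro iffD2[OF AE_ball_countable[OF D(1)]] ballI)
  then have "AE x in lebesgue. x \<in> \<Omega> \<longrightarrow> h x = 0"
    by eventually_elim (use D(4) in auto)
  then show ?thesis using \<Omega> by (simp add: AE_restrict_space_iff)
qed

lemma has_weak_deriv_unique:
  fixes \<Omega> :: "(real^'n::finite) set"
  assumes "open \<Omega>" and g: "has_weak_deriv \<Omega> \<eta> v g" and g': "has_weak_deriv \<Omega> \<eta> v g'"
  shows "AE x in lebesgue_on \<Omega>. g x = g' x"
proof -
  have \<Omega>: "\<Omega> \<in> sets lebesgue" using assms(1) by auto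
  have int: "integrable (lebesgue_on \<Omega>) (\<lambda>x. f x * \<phi> x)"
    if f: "locally_integrable \<Omega> f" and \<phi>: "\<phi> \<in> test_functions \<Omega>" for f \<phi> :: "real^'n \<Rightarrow> real"
  proof -
    let ?K = "closure {x. \<phi> x \<noteq> 0}"
    have K: "compact ?K" "?K \<subseteq> \<Omega>" using \<phi> by (auto simp: test_functions_def)
    then have "integrable (lebesgue_on ?K) f" using f by (simp add: locally_integrable_def)
    moreover have KL: "?K \<in> sets lebesgue" by simp
    ultimately have fK: "integrable lebesgue (\<lambda>x. indicator ?K x * f x)"
      by (simp add: integrable_restrict_space)
    obtain M where M: "0 \<le> M" "\<And>x. \<bar>\<phi> x\<bar> \<le> M" using test_functions_bounded[OF \<phi>] by blast
    have "integrable lebesgue (\<lambda>x. \<phi> x * (indicator ?K x * f x))"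
    proof (rule Bochner_Integration.integrable_bound)
      show "integrable lebesgue (\<lambda>x. M * (indicator ?K x * f x))" using fK by simp
      show "(\<lambda>x. \<phi> x * (indicator ?K x * f x)) \<in> borel_measurable lebesgue"
        by (rule borel_measurable_times[OF measurable_completion borel_measurable_integrable[OF fK]])
           (use test_functions_measurable[OF \<phi>] in simp)
      show "AE x in lebesgue. norm (\<phi> x * (indicator ?K x * f x)) \<le> norm (M * (indicator ?K x * f x))"
        using M by (intro AE_I2) (auto simp: abs_mult mult_right_mono indicator_def)
    qed
    moreover have "\<phi> x * (indicator ?K x * f x) = indicator \<Omega> x * (f x * \<phi> x)" for x
      using K(2) closure_subset[of "{x. \<phi> x \<noteq> 0}"] by (cases "\<phi> x = 0") (auto simp: indicator_def)
    ultimately show ?thesis using \<Omega> by (simp add: integrable_restrict_space)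
  qed
  have "AE x in lebesgue_on \<Omega>. g x - g' x = 0"
  proof (rule AE_zero_if_test_integrals_zero[OF assms(1)])
    show "locally_integrable \<Omega> (\<lambda>x. g x - g' x)"
      using g g' by (auto simp: has_weak_deriv_def locally_integrable_def)
    fix \<phi> :: "real^'n \<Rightarrow> real" assume \<phi>: "\<phi> \<in> test_functions \<Omega>"
    have "integral\<^sup>L (lebesgue_on \<Omega>) (\<lambda>x. g x * \<phi> x) = integral\<^sup>L (lebesgue_on \<Omega>) (\<lambda>x. g' x * \<phi> x)"
      using g g' \<phi> by (auto simp: has_weak_deriv_def)
    moreover have "integrable (lebesgue_on \<Omega>) (\<lambda>x. g x * \<phi> x)" "integrable (lebesgue_on \<Omega>) (\<lambda>x. g' x * \<phi> x)"
      using g g' \<phi> by (auto simp: has_weak_deriv_def int)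
    ultimately show "integral\<^sup>L (lebesgue_on \<Omega>) (\<lambda>x. (g x - g' x) * \<phi> x) = 0"
      by (simp add: left_diff_distrib)
  qed
  then show ?thesis by simp
qed

text \<open>The Sobolev norm refers to a weak derivative picked by choice; by uniqueness it can be computed from any
weak derivative.\<close>

lemma weak_deriv_AE_eq:
  assumes "open \<Omega>" "has_weak_deriv \<Omega> \<eta> v g"
  shows "AE x in lebesgue_on \<Omega>. weak_deriv \<Omega> \<eta> v x = g x"
  using has_weak_deriv_unique[OF assms(1) _ assms(2)] someI[of "has_weak_deriv \<Omega> \<eta> v", OF assms(2)]
  unfolding weak_deriv_def by blast

section \<open>Potentials with an integrable kernel on weighted Lebesgue spaces\<close>

text \<open>The closed ball of the maximum norm about the origin. Its translates are the cubes of the Muckenhoupt condition,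
and membership of \<open>x - y\<close> is symmetric in \<open>x\<close> and \<open>y\<close>.\<close>

definition sup_cball :: "real \<Rightarrow> (real^'n::finite) set" where
  "sup_cball \<rho> = {z. \<forall>i. \<bar>z $ i\<bar> \<le> \<rho>}"

lemma sup_cball_borel [measurable]: "(sup_cball \<rho> :: (real^'n::finite) set) \<in> sets borel"
proof -
  have "(sup_cball \<rho> :: (real^'n::finite) set) = cbox (\<chi> i. - \<rho>) (\<chi> i. \<rho>)"
    by (auto simp: sup_cball_def mem_box_cart abs_le_iff minus_le_iff)
  then show ?thesis by simp
qed

lemma sup_cball_symmetric: "x - y \<in> sup_cball \<rho> \<longleftrightarrow> y - x \<in> sup_cball \<rho>"
  by (simp add: sup_cball_def abs_minus_commute)

lemma sup_cball_add: "u \<in> sup_cball \<rho> \<Longrightarrow> v \<in> sup_cball \<rho>' \<Longrightarrow> u + v \<in> sup_cball (\<rho> + \<rho>')"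
  unfolding sup_cball_def by (auto intro: order_trans[OF abs_triangle_ineq] add_mono)

lemma sup_cball_mono: "\<rho> \<le> \<rho>' \<Longrightarrow> sup_cball \<rho> \<subseteq> sup_cball \<rho>'"
  by (auto simp: sup_cball_def intro: order_trans)

lemma norm_le_in_sup_cball: "norm z \<le> \<rho> \<Longrightarrow> z \<in> sup_cball \<rho>"
  unfolding sup_cball_def using component_le_norm_cart order_trans by blast

lemma translated_sup_cball: "{y. x - y \<in> sup_cball \<rho>} = cube (x - (\<chi> i. \<rho>)) (2 * \<rho>)"
  by (auto simp: sup_cball_def cube_def mem_box_cart abs_le_iff) (smt (verit))+

lemma measure_cube:
  assumes "0 \<le> l"
  shows "emeasure lborel (cube (a :: real^'n::finite) l) = ennreal (l ^ CARD('n))"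
    and "measure lebesgue (cube a l) = l ^ CARD('n)"
proof -
  have ne: "cube a l \<noteq> {}" using assms by (auto simp: cube_def interval_ne_empty_cart)
  have "measure lborel (cube a l) = l ^ CARD('n)"
    using ne unfolding cube_def by (subst content_cbox_cart) auto
  then show "measure lebesgue (cube a l) = l ^ CARD('n)" "emeasure lborel (cube a l) = ennreal (l ^ CARD('n))"
    using emeasure_eq_ennreal_measure[of lborel "cbox a (a + (\<chi> i. l))"] emeasure_lborel_cbox_finite[of a "a + (\<chi> i. l)"]
    by (auto simp: cube_def)
qed

text \<open>A discretisation of \<open>1 / |x - y|\<close> for \<open>|x - y| \<le> D\<close>. The potential with this kernel is a weighted sum of the
operators \<open>f \<mapsto> (\<lambda>x. \<integral> f)\<close>, with integrals over the cubes of half side \<open>D 2\<^sup>-\<^sup>j\<close> about \<open>x\<close>.\<close>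

definition dyadic_kernel :: "real \<Rightarrow> real^'n::finite \<Rightarrow> real^'n \<Rightarrow> ennreal" where
  "dyadic_kernel D x y =
     (\<Sum>j. ennreal (2 powr (real j + 1) / D) * indicator (sup_cball (D * 2 powr - real j)) (x - y))"

lemma dyadic_kernel_measurable [measurable]:
  assumes [measurable]: "f \<in> borel_measurable M" "g \<in> borel_measurable M"
  shows "(\<lambda>x. dyadic_kernel D (f x) (g x)) \<in> borel_measurable M"
  unfolding dyadic_kernel_def by measurable

lemma dyadic_kernel_commute: "dyadic_kernel D x y = dyadic_kernel D y x"
  unfolding dyadic_kernel_def indicator_def by (subst sup_cball_symmetric) simp

lemma inverse_norm_le_dyadic_kernel:
  assumes "x \<noteq> y" "norm (x - y) \<le> D"
  shows "ennreal (1 / norm (x - y)) \<le> dyadic_kernel D x y"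
proof -
  define r where "r = norm (x - y)"
  have r: "0 < r" "r \<le> D" using assms by (auto simp: r_def)
  obtain n where n: "D / r < 2 ^ n"
    using real_arch_pow[of 2 "D / r"] by auto
  (* The scale of \<open>r\<close>: the term of index \<open>j\<close> with \<open>D / 2 ^ (j + 1) < r \<le> D / 2 ^ j\<close> already dominates. *)
  define j where "j = (LEAST j. D / r < 2 ^ Suc j)"
  define T where "T j = ennreal (2 powr (real j + 1) / D) * indicator (sup_cball (D * 2 powr - real j)) (x - y)" for j
  have "D / r < 2 ^ Suc n" using n by (simp add: less_trans[OF n])
  then have j1: "D / r < 2 ^ Suc j" unfolding j_def by (rule LeastI)
  have j2: "2 ^ j \<le> D / r"
  proof (cases j)
    case 0 then show ?thesis using r by simp
  next
    case (Suc i)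
    then have "\<not> D / r < 2 ^ Suc i" using not_less_Least[of i "\<lambda>j. D / r < 2 ^ Suc j"] unfolding j_def by auto
    then show ?thesis using Suc by simp
  qed
  have p: "2 powr (real j + 1) = 2 ^ Suc j" "2 powr - real j = 1 / 2 ^ j"
    by (simp_all add: powr_add powr_realpow powr_minus_divide)
  have "norm (x - y) \<le> D * 2 powr - real j"
    using j2 r unfolding p r_def[symmetric] by (simp add: field_simps)
  then have "x - y \<in> sup_cball (D * 2 powr - real j)" by (rule norm_le_in_sup_cball)
  moreover have "1 / r \<le> 2 powr (real j + 1) / D"
    using j1 r unfolding p by (simp add: field_simps)
  ultimately have "ennreal (1 / r) \<le> T j"
    by (simp add: T_def ennreal_leI)
  also have "T j \<le> dyadic_kernel D x y"
    unfolding dyadic_kernel_def T_def[symmetric] using sum_le_suminf[of T "{j}"] by simp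
  finally show ?thesis by (simp add: r_def)
qed

lemma suminf_ennreal_half: "(\<Sum>j. ennreal (c * (1 / 2) ^ j)) = ennreal (2 * c)" if "0 \<le> c"
proof -
  have "(\<lambda>j. c * (1 / 2) ^ j :: real) sums (c * 2)"
    using sums_mult[OF geometric_sums[of "1/2::real"], of c] by simp
  then show ?thesis using that by (intro suminf_ennreal_eq) (auto simp: mult.commute)
qed

text \<open>Scale \<open>j\<close> contributes a multiple of \<open>2\<^sup>j\<close> times the volume \<open>(2 D)\<^sup>n 2\<^sup>-\<^sup>j\<^sup>n\<close> of a cube; for \<open>n \<ge> 2\<close> the
sum is geometric.\<close>

lemma nn_integral_dyadic_kernel:
  assumes "2 \<le> CARD('n::finite)" "0 < D"
  shows "(\<integral>\<^sup>+y. dyadic_kernel D (x :: real^'n) y \<partial>lborel) \<le> ennreal (2 * (2 / D * (2 * D) ^ CARD('n)))"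
proof -
  let ?n = "CARD('n)"
  have e: "(\<integral>\<^sup>+y. indicator (sup_cball \<rho>) (x - y) \<partial>lborel) = ennreal ((2 * \<rho>) ^ ?n)" if "0 \<le> \<rho>" for \<rho>
  proof -
    have "(\<integral>\<^sup>+y. indicator (sup_cball \<rho>) (x - y) \<partial>lborel) = (\<integral>\<^sup>+y. indicator {y. x - y \<in> sup_cball \<rho>} y \<partial>lborel)"
      by (intro nn_integral_cong) (simp add: indicator_def)
    also have "\<dots> = emeasure lborel (cube (x - (\<chi> i. \<rho>)) (2 * \<rho>))"
      unfolding translated_sup_cball by (rule nn_integral_indicator) (simp add: cube_def)
    finally show ?thesis using that by (simp add: measure_cube)
  qed
  have "(\<integral>\<^sup>+y. dyadic_kernel D x y \<partial>lborel) =
     (\<Sum>j. ennreal (2 powr (real j + 1) / D) * (\<integral>\<^sup>+y. indicator (sup_cball (D * 2 powr - real j)) (x - y) \<partial>lborel))"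
    unfolding dyadic_kernel_def by (subst nn_integral_suminf) (auto simp: nn_integral_cmult)
  also have "\<dots> \<le> (\<Sum>j. ennreal (2 / D * (2 * D) ^ ?n * (1 / 2) ^ j))"
  proof (intro suminf_le)
    fix j :: nat
    have p: "2 powr (real j + 1) = 2 * 2 ^ j" "2 powr - real j = 1 / 2 ^ j"
      by (simp_all add: powr_add powr_realpow powr_minus_divide)
    have "((1 / 2 ^ j :: real)) ^ ?n \<le> (1 / 2 ^ j) ^ 2"
      using assms by (intro power_decreasing) auto
    then have "2 ^ j * (1 / 2 ^ j) ^ ?n \<le> (2 ^ j * (1 / 2 ^ j)\<^sup>2 :: real)" by simp
    also have "\<dots> = (1 / 2) ^ j" by (simp add: power2_eq_square power_one_over)
    finally have "2 / D * (2 * D) ^ ?n * (2 ^ j * (1 / 2 ^ j) ^ ?n) \<le> 2 / D * (2 * D) ^ ?n * (1 / 2) ^ j"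
      using assms by (intro mult_left_mono) auto
    moreover have "2 / D * (2 * D) ^ ?n * (2 ^ j * (1 / 2 ^ j) ^ ?n) = 2 * 2 ^ j / D * (2 * (D * (1 / 2 ^ j))) ^ ?n"
    proof -
      have "(2 * (D * (1 / 2 ^ j))) ^ ?n = (2 * D) ^ ?n * (1 / 2 ^ j) ^ ?n"
        by (simp only: power_mult_distrib[symmetric] mult.assoc)
      then show ?thesis by (simp only: divide_inverse ac_simps)
    qed
    ultimately have "2 * 2 ^ j / D * (2 * (D * (1 / 2 ^ j))) ^ ?n \<le> 2 / D * (2 * D) ^ ?n * (1 / 2) ^ j"
      by (simp only:)
    then have "ennreal (2 * 2 ^ j / D * (2 * (D * (1 / 2 ^ j))) ^ ?n) \<le> ennreal (2 / D * (2 * D) ^ ?n * (1 / 2) ^ j)"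
      by (rule ennreal_leI)
    then show "ennreal (2 powr (real j + 1) / D) * (\<integral>\<^sup>+y. indicator (sup_cball (D * 2 powr - real j)) (x - y) \<partial>lborel)
        \<le> ennreal (2 / D * (2 * D) ^ ?n * (1 / 2) ^ j)"
      unfolding p using assms by (subst e) (auto simp flip: ennreal_mult)
  qed auto
  also have "\<dots> = ennreal (2 * (2 / D * (2 * D) ^ ?n))"
    using assms by (intro suminf_ennreal_half) auto
  finally show ?thesis .
qed

text \<open>Young's inequality for \<open>a = (t a w\<^sup>1\<^sup>/\<^sup>p) (t\<^sup>-\<^sup>1 w\<^sup>-\<^sup>1\<^sup>/\<^sup>p)\<close>. With the free parameter \<open>t\<close> it replaces
Hoelder's inequality: it is linear in its two terms and can be integrated and summed before \<open>t\<close> is chosen.\<close>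

lemma weighted_Young:
  fixes a t w p :: real
  assumes "0 \<le> a" "0 < t" "0 < w" "1 < p"
  shows "a \<le> t powr p * (a powr p * w) + t powr - (p / (p - 1)) * w powr (- 1 / (p - 1))"
proof -
  define q where "q = p / (p - 1)"
  have q: "1 < q" "1 / p + 1 / q = 1" "q / p = 1 / (p - 1)"
    using assms(4) by (auto simp: q_def field_simps)
  define u v where "u = t * a * w powr (1 / p)" and "v = t powr - 1 * w powr (- (1 / p))"
  have "u * v = a" using assms by (simp add: u_def v_def powr_minus field_simps)
  moreover have "u * v \<le> u powr p / p + v powr q / q"
    using assms q by (intro Youngs_inequality) (auto simp: u_def v_def)
  moreover have "u powr p / p \<le> u powr p"
    using assms by (simp add: divide_le_eq mult_le_cancel_left1)
  moreover have "v powr q / q \<le> v powr q"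
    using q by (simp add: divide_le_eq mult_le_cancel_left1)
  moreover have "u powr p = t powr p * (a powr p * w)"
    using assms by (simp add: u_def powr_mult powr_powr)
  moreover have "v powr q = t powr - q * w powr (- 1 / (p - 1))"
    using assms q(3) by (simp add: v_def powr_mult powr_divide powr_powr powr_minus_divide)
  ultimately show ?thesis by (simp add: q_def)
qed

text \<open>Optimising over the parameter turns a family of additive bounds back into a bound of Hoelder type. The choice
\<open>s = g\<^sup>-\<^sup>1\<^sup>/\<^sup>(\<^sup>p\<^sup>q\<^sup>)\<close> makes \<open>s\<^sup>p g\<close> and \<open>s\<^sup>-\<^sup>q\<close> both equal to \<open>g\<^sup>1\<^sup>/\<^sup>p\<close>; to have \<open>g > 0\<close>, the value of
\<open>G\<close> is approached from above.\<close>

lemma powr_le_if_Young_bounds: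
  fixes I G :: ennreal and h p c :: real
  assumes p: "1 < p" and h: "0 \<le> h" "ennreal h \<le> I"
    and I: "\<And>s. 0 < s \<Longrightarrow> I \<le> ennreal (s powr p) * G + ennreal (2 * s powr - (p / (p - 1)))"
  shows "ennreal (h powr p) \<le> ennreal (3 powr p) * G"
proof (cases G)
  case (real g0)
  have "h powr p \<le> 3 powr p * (g0 + e)" if e: "0 < e" for e
  proof -
    define g where "g = g0 + e"
    define q where "q = p / (p - 1)"
    have g: "0 < g" "g0 \<le> g" using real e by (auto simp: g_def)
    have pq: "1 / p + 1 / q = 1" "0 < q" using p by (auto simp: q_def field_simps)
    define s where "s = g powr (- 1 / (p * q))"
    have s: "0 < s" using g by (simp add: s_def)
    have "s powr p * g = g powr (- 1 / q + 1)"
      using p pq g powr_add[of g "- 1 / q" 1] by (simp add: s_def powr_powr)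
    also have "- 1 / q + 1 = 1 / p" using pq by simp
    finally have 1: "s powr p * g = g powr (1 / p)" .
    have 2: "s powr - q = g powr (1 / p)" using p pq by (simp add: s_def powr_powr)
    have "ennreal h \<le> ennreal (s powr p) * G + ennreal (2 * s powr - (p / (p - 1)))"
      using h(2) I[OF s] by (rule order_trans)
    also have "\<dots> = ennreal (s powr p * g0 + 2 * s powr - q)"
      using real by (simp add: q_def ennreal_mult ennreal_plus)
    also have "\<dots> \<le> ennreal (3 * g powr (1 / p))"
      using 1 2 mult_left_mono[OF g(2), of "s powr p"] by (intro ennreal_leI) auto
    finally have "h \<le> 3 * g powr (1 / p)" using g by (simp add: ennreal_le_iff2)
    then have "h powr p \<le> (3 * g powr (1 / p)) powr p" using h p by (intro powr_mono2) auto
    also have "\<dots> = 3 powr p * g" using g p by (simp add: powr_mult powr_powr)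
    finally show ?thesis by (simp add: g_def)
  qed
  then have "h powr p \<le> 3 powr p * g0 + e" if "0 < e" for e
    using that[THEN divide_pos_pos, of "3 powr p"] by (fastforce simp: distrib_left)
  then have "h powr p \<le> 3 powr p * g0" by (rule field_le_epsilon)
  then show ?thesis using real by (simp add: ennreal_leI flip: ennreal_mult)
qed (simp add: ennreal_mult_top)

text \<open>The analytic core. Write \<open>Q\<^sub>j(x)\<close> for the cube of half side \<open>\<rho>\<^sub>j = D 2\<^sup>-\<^sup>j\<close> about \<open>x\<close>, \<open>\<sigma>\<close> for the dual weight and
\<open>S\<^sub>j(x)\<close> for the integral of \<open>\<sigma>\<close> over \<open>Q\<^sub>j(x)\<close>. Young's inequality on every scale bounds the potential of \<open>f\<close> at
\<open>x\<close>, up to optimisation, by the \<open>p\<close>-th root of \<open>G(x)\<close>, the sum over \<open>j\<close> of a multiple of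
\<open>S\<^sub>j(x)\<^sup>p\<^sup>-\<^sup>1\<close> times the integral of \<open>f\<^sup>p w\<close> over \<open>Q\<^sub>j(x)\<close>.
Now integrate \<open>G w\<close> and interchange the integrals. The cube \<open>Q\<^sub>j(x)\<close> about a point \<open>x\<close> of \<open>Q\<^sub>j(y)\<close> lies in the
doubled cube about \<open>y\<close>, so a single application of the Muckenhoupt condition to that cube bounds the inner integral
by a multiple of \<open>\<rho>\<^sub>j\<^sup>n\<^sup>p\<close>. Together with the coefficient \<open>2\<^sup>j\<^sup>(\<^sup>2\<^sup>p\<^sup>-\<^sup>1\<^sup>)\<close> this is at most a multiple of \<open>2\<^sup>-\<^sup>j\<close>
when \<open>n \<ge> 2\<close>.\<close>

lemma dyadic_potential_bound:
  fixes w \<sigma> :: "real^'n::finite \<Rightarrow> real" and p D A :: real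
  assumes n: "2 \<le> CARD('n)" and p: "1 < p" and D: "0 < D"
    and [measurable]: "w \<in> borel_measurable borel"
    and w0: "\<And>x. 0 \<le> w x" and w_pos: "AE x in lborel. 0 < w x"
    and \<sigma>: "\<sigma> = (\<lambda>x. w x powr (- 1 / (p - 1)))"
    and w_int: "\<And>x \<rho>. 0 < \<rho> \<Longrightarrow> integrable lborel (\<lambda>y. indicator (sup_cball \<rho>) (x - y) * w y)"
    and \<sigma>_int: "\<And>x \<rho>. 0 < \<rho> \<Longrightarrow> integrable lborel (\<lambda>y. indicator (sup_cball \<rho>) (x - y) * \<sigma> y)"
    and Ap: "\<And>x \<rho>. 0 < \<rho> \<Longrightarrow> (\<integral>y. indicator (sup_cball \<rho>) (x - y) * w y \<partial>lborel) *
        (\<integral>y. indicator (sup_cball \<rho>) (x - y) * \<sigma> y \<partial>lborel) powr (p - 1) \<le> A * \<rho> powr (CARD('n) * p)"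
  shows "\<exists>C>0. \<forall>f h. f \<in> borel_measurable borel \<longrightarrow> (\<forall>y. 0 \<le> f y) \<longrightarrow>
     h \<in> borel_measurable borel \<longrightarrow> (\<forall>x. 0 \<le> h x) \<longrightarrow>
     (AE x in lborel. ennreal (h x) \<le> (\<integral>\<^sup>+y. dyadic_kernel D x y * ennreal (f y) \<partial>lborel)) \<longrightarrow>
     (\<integral>\<^sup>+x. ennreal (h x powr p * w x) \<partial>lborel) \<le> ennreal C * (\<integral>\<^sup>+y. ennreal (f y powr p * w y) \<partial>lborel)"
proof -
  define q where "q = p / (p - 1)"
  have q: "0 < q" "p / q = p - 1" using p by (auto simp: q_def field_simps)
  have [measurable]: "\<sigma> \<in> borel_measurable borel" unfolding \<sigma> by measurable
  define b where "b j = 2 powr (real j + 1) / D" for j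
  define \<rho> where "\<rho> j = D * 2 powr - real j" for j
  define S where "S \<rho> x = (\<integral>y. indicator (sup_cball \<rho>) (x - y) * \<sigma> y \<partial>lborel)" for \<rho> x
  have b: "0 < b j" for j using D by (simp add: b_def)
  have \<rho>: "0 < \<rho> j" for j using D by (simp add: \<rho>_def)
  have [measurable]: "S \<rho> \<in> borel_measurable borel" for \<rho>
    unfolding S_def by measurable
  have S_nn: "(\<integral>\<^sup>+y. indicator (sup_cball \<rho>) (x - y) * ennreal (\<sigma> y) \<partial>lborel) = ennreal (S \<rho> x)" if "0 < \<rho>" for \<rho> x
    unfolding S_def using \<sigma>_int[OF that, of x]
    by (subst nn_integral_eq_integral[symmetric]) (auto simp: \<sigma> intro!: nn_integral_cong split: split_indicator)
  have S_pos: "0 < S \<rho> x" if "0 < \<rho>" for \<rho> x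
  proof (rule ccontr)
    assume "\<not> 0 < S \<rho> x"
    then have "(\<integral>\<^sup>+y. indicator (sup_cball \<rho>) (x - y) * ennreal (\<sigma> y) \<partial>lborel) = 0"
      using S_nn[OF that, of x] by (simp add: ennreal_neg)
    then have "AE y in lborel. indicator (sup_cball \<rho>) (x - y) * ennreal (\<sigma> y) = 0"
      by (subst (asm) nn_integral_0_iff_AE) auto
    then have "AE y in lborel. y \<notin> {y. x - y \<in> sup_cball \<rho>}"
      using w_pos by eventually_elim (auto simp: indicator_def \<sigma>)
    then have "emeasure lborel {y. x - y \<in> sup_cball \<rho>} = 0"
      by (subst (asm) AE_iff_measurable[OF _ refl]) (auto simp: translated_sup_cball cube_def)
    then have "(2 * \<rho>) ^ CARD('n) \<le> 0"
      using that by (simp add: translated_sup_cball measure_cube ennreal_eq_0_iff)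
    then show False using that zero_less_power[of "2 * \<rho>" "CARD('n)"] by linarith
  qed
  define c where "c j x = b j * (2 powr real j * b j * S (\<rho> j) x) powr (p - 1)" for j x
  have [measurable]: "c j \<in> borel_measurable borel" for j unfolding c_def by measurable
  define C0 where "C0 = \<bar>A\<bar> * (2 / D) powr p * (2 * D) powr (CARD('n) * p)"
  define C where "C = 3 powr p * (2 * C0) + 1"
  have C0: "0 \<le> C0" using D by (simp add: C0_def)
  then have C: "0 < C" by (simp add: C_def add_nonneg_pos)
  show ?thesis
  proof (intro exI[of _ C] conjI C allI impI)
    fix f h :: "real^'n \<Rightarrow> real"
    assume [measurable]: "f \<in> borel_measurable borel" "h \<in> borel_measurable borel"
      and f0: "\<forall>y. 0 \<le> f y" and h0: "\<forall>x. 0 \<le> h x"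
      and hI: "AE x in lborel. ennreal (h x) \<le> (\<integral>\<^sup>+y. dyadic_kernel D x y * ennreal (f y) \<partial>lborel)"
    define F where "F y = ennreal (f y powr p * w y)" for y
    have [measurable]: "F \<in> borel_measurable borel" unfolding F_def by measurable
    define J where "J j x = (\<integral>\<^sup>+y. indicator (sup_cball (\<rho> j)) (x - y) * F y \<partial>lborel)" for j x
    have [measurable]: "J j \<in> borel_measurable borel" for j unfolding J_def by measurable
    define G where "G x = (\<Sum>j. ennreal (c j x) * J j x)" for x
    have [measurable]: "G \<in> borel_measurable borel" unfolding G_def by measurable
    have I_split: "(\<integral>\<^sup>+y. dyadic_kernel D x y * ennreal (f y) \<partial>lborel) =
        (\<Sum>j. ennreal (b j) * (\<integral>\<^sup>+y. indicator (sup_cball (\<rho> j)) (x - y) * ennreal (f y) \<partial>lborel))" for x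
    proof -
      have "(\<integral>\<^sup>+y. dyadic_kernel D x y * ennreal (f y) \<partial>lborel) =
         (\<integral>\<^sup>+y. (\<Sum>j. ennreal (b j) * (indicator (sup_cball (\<rho> j)) (x - y) * ennreal (f y))) \<partial>lborel)"
        unfolding dyadic_kernel_def b_def \<rho>_def by (simp flip: ennreal_suminf_multc add: mult.assoc)
      also have "\<dots> = (\<Sum>j. ennreal (b j) * (\<integral>\<^sup>+y. indicator (sup_cball (\<rho> j)) (x - y) * ennreal (f y) \<partial>lborel))"
        by (subst nn_integral_suminf) (auto simp: nn_integral_cmult)
      finally show ?thesis .
    qed
    have scale: "ennreal (b j) * (\<integral>\<^sup>+y. indicator (sup_cball (\<rho> j)) (x - y) * ennreal (f y) \<partial>lborel)
        \<le> ennreal (s powr p) * (ennreal (c j x) * J j x) + ennreal (s powr - q * (1 / 2) ^ j)" if s: "0 < s" for s j x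
    proof -
      (* Chosen so that the term with the dual weight contributes \<open>s powr - q * (1 / 2) ^ j\<close> to the sum over the scales. *)
      define \<tau> where "\<tau> = (2 powr real j * b j * S (\<rho> j) x) powr (1 / q)"
      have \<tau>: "0 < \<tau>" using b[of j] S_pos[OF \<rho>, of j x] by (simp add: \<tau>_def)
      have "(\<integral>\<^sup>+y. indicator (sup_cball (\<rho> j)) (x - y) * ennreal (f y) \<partial>lborel) \<le>
        (\<integral>\<^sup>+y. ennreal ((s * \<tau>) powr p) * (indicator (sup_cball (\<rho> j)) (x - y) * F y) +
              ennreal ((s * \<tau>) powr - q) * (indicator (sup_cball (\<rho> j)) (x - y) * ennreal (\<sigma> y)) \<partial>lborel)"
      proof (rule nn_integral_mono_AE)
        show "AE y in lborel. indicator (sup_cball (\<rho> j)) (x - y) * ennreal (f y) \<le>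
           ennreal ((s * \<tau>) powr p) * (indicator (sup_cball (\<rho> j)) (x - y) * F y) +
              ennreal ((s * \<tau>) powr - q) * (indicator (sup_cball (\<rho> j)) (x - y) * ennreal (\<sigma> y))"
          using w_pos
        proof eventually_elim
          case (elim y)
          have "f y \<le> (s * \<tau>) powr p * (f y powr p * w y) + (s * \<tau>) powr - q * \<sigma> y"
            unfolding q_def \<sigma> using s \<tau> elim f0 p by (intro weighted_Young) auto
          then have "ennreal (f y) \<le> ennreal ((s * \<tau>) powr p * (f y powr p * w y) + (s * \<tau>) powr - q * \<sigma> y)"
            by (rule ennreal_leI)
          also have "\<dots> = ennreal ((s * \<tau>) powr p) * F y + ennreal ((s * \<tau>) powr - q) * ennreal (\<sigma> y)"
            using elim by (simp add: F_def \<sigma> ennreal_plus ennreal_mult)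
          finally show ?case by (simp add: indicator_def)
        qed
      qed
      also have "\<dots> = ennreal ((s * \<tau>) powr p) * J j x + ennreal ((s * \<tau>) powr - q) * ennreal (S (\<rho> j) x)"
        unfolding J_def S_nn[OF \<rho>, symmetric] by (subst nn_integral_add) (auto simp: nn_integral_cmult)
      finally have "ennreal (b j) * (\<integral>\<^sup>+y. indicator (sup_cball (\<rho> j)) (x - y) * ennreal (f y) \<partial>lborel)
        \<le> ennreal (b j) * (ennreal ((s * \<tau>) powr p) * J j x + ennreal ((s * \<tau>) powr - q) * ennreal (S (\<rho> j) x))"
        by (rule mult_left_mono) simp
      also have "\<dots> = ennreal (b j * (s * \<tau>) powr p) * J j x + ennreal (b j * ((s * \<tau>) powr - q * S (\<rho> j) x))"
        using b[of j] S_pos[OF \<rho>, of j x] by (simp add: distrib_left ennreal_mult mult.assoc)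
      also have "b j * (s * \<tau>) powr p = s powr p * c j x"
      proof -
        have "\<tau> powr p = (2 powr real j * b j * S (\<rho> j) x) powr (p - 1)"
          using q by (simp add: \<tau>_def powr_powr)
        then show ?thesis by (simp add: c_def powr_mult[of s \<tau>] del: powr_mult)
      qed
      also have "b j * ((s * \<tau>) powr - q * S (\<rho> j) x) = s powr - q * (1 / 2) ^ j"
      proof -
        have "\<tau> powr - q = 1 / (2 powr real j * b j * S (\<rho> j) x)"
          using b[of j] S_pos[OF \<rho>, of j x] q by (simp add: \<tau>_def powr_powr powr_minus_divide)
        then show ?thesis using s \<tau> b[of j] S_pos[OF \<rho>, of j x]
          by (simp add: powr_mult powr_realpow power_one_over field_simps)
      qed
      finally show ?thesis using b[of j] by (simp add: ennreal_mult' c_def mult.assoc)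
    qed
    have I_le: "(\<integral>\<^sup>+y. dyadic_kernel D x y * ennreal (f y) \<partial>lborel)
        \<le> ennreal (s powr p) * G x + ennreal (2 * s powr - q)" if s: "0 < s" for s x
    proof -
      have "(\<integral>\<^sup>+y. dyadic_kernel D x y * ennreal (f y) \<partial>lborel) \<le>
         (\<Sum>j. ennreal (s powr p) * (ennreal (c j x) * J j x) + ennreal (s powr - q * (1 / 2) ^ j))"
        unfolding I_split by (intro suminf_le scale s) auto
      also have "\<dots> = ennreal (s powr p) * G x + ennreal (2 * s powr - q)"
        unfolding G_def suminf_add[symmetric, OF summableI summableI] ennreal_suminf_cmult
          suminf_ennreal_half[OF powr_ge_zero] ..
      finally show ?thesis .
    qed
    have "(\<integral>\<^sup>+x. ennreal (h x powr p * w x) \<partial>lborel) \<le> (\<integral>\<^sup>+x. ennreal (3 powr p) * (G x * ennreal (w x)) \<partial>lborel)"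
    proof (rule nn_integral_mono_AE)
      show "AE x in lborel. ennreal (h x powr p * w x) \<le> ennreal (3 powr p) * (G x * ennreal (w x))"
        using hI
      proof eventually_elim
        case (elim x)
        have "ennreal (h x powr p) \<le> ennreal (3 powr p) * G x"
          using p h0 elim I_le[of _ x] unfolding q_def by (intro powr_le_if_Young_bounds) auto
        then have "ennreal (h x powr p) * ennreal (w x) \<le> ennreal (3 powr p) * G x * ennreal (w x)"
          by (rule mult_right_mono) simp
        then show ?case using w0 by (simp add: ennreal_mult mult.assoc)
      qed
    qed
    also have "\<dots> = ennreal (3 powr p) * (\<integral>\<^sup>+x. G x * ennreal (w x) \<partial>lborel)"
      by (rule nn_integral_cmult) measurable
    finally have hG: "(\<integral>\<^sup>+x. ennreal (h x powr p * w x) \<partial>lborel)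
       \<le> ennreal (3 powr p) * (\<integral>\<^sup>+x. G x * ennreal (w x) \<partial>lborel)" .
    have "(\<integral>\<^sup>+x. G x * ennreal (w x) \<partial>lborel) = (\<Sum>j. \<integral>\<^sup>+x. ennreal (c j x) * J j x * ennreal (w x) \<partial>lborel)"
      unfolding G_def by (simp flip: ennreal_suminf_multc add: nn_integral_suminf)
    also have "\<dots> \<le> (\<Sum>j. ennreal (C0 * (1 / 2) ^ j) * (\<integral>\<^sup>+y. F y \<partial>lborel))"
    proof (intro suminf_le)
      fix j
      have "(\<integral>\<^sup>+x. ennreal (c j x) * J j x * ennreal (w x) \<partial>lborel)
        = (\<integral>\<^sup>+x. (\<integral>\<^sup>+y. ennreal (c j x) * ennreal (w x) * indicator (sup_cball (\<rho> j)) (x - y) * F y \<partial>lborel) \<partial>lborel)"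
        unfolding J_def by (simp flip: nn_integral_cmult nn_integral_multc add: ac_simps)
      also have "\<dots> = (\<integral>\<^sup>+y. (\<integral>\<^sup>+x. ennreal (c j x) * ennreal (w x) * indicator (sup_cball (\<rho> j)) (x - y) * F y \<partial>lborel) \<partial>lborel)"
        by (rule lborel_pair.Fubini') measurable
      also have "\<dots> \<le> (\<integral>\<^sup>+y. ennreal (C0 * (1 / 2) ^ j) * F y \<partial>lborel)"
      proof (rule nn_integral_mono)
        fix y
        let ?k = "b j * (2 powr real j * b j) powr (p - 1)"
        have k: "0 \<le> ?k" using b[of j] by simp
        have \<rho>2: "0 < 2 * \<rho> j" using \<rho>[of j] by simp
        have "(\<integral>\<^sup>+x. ennreal (c j x) * ennreal (w x) * indicator (sup_cball (\<rho> j)) (x - y) \<partial>lborel)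
          \<le> (\<integral>\<^sup>+x. ennreal (?k * S (2 * \<rho> j) y powr (p - 1)) * ennreal (indicator (sup_cball (2 * \<rho> j)) (y - x) * w x) \<partial>lborel)"
        proof (rule nn_integral_mono)
          fix x
          show "ennreal (c j x) * ennreal (w x) * indicator (sup_cball (\<rho> j)) (x - y) \<le>
             ennreal (?k * S (2 * \<rho> j) y powr (p - 1)) * ennreal (indicator (sup_cball (2 * \<rho> j)) (y - x) * w x)"
          proof (cases "x - y \<in> sup_cball (\<rho> j)")
            case True
            then have yx: "y - x \<in> sup_cball (\<rho> j)" by (simp add: sup_cball_symmetric)
            then have y2: "y - x \<in> sup_cball (2 * \<rho> j)" using sup_cball_mono[of "\<rho> j" "2 * \<rho> j"] \<rho>[of j] by auto
            have "S (\<rho> j) x \<le> S (2 * \<rho> j) y"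
              unfolding S_def
            proof (rule integral_mono[OF \<sigma>_int[OF \<rho>] \<sigma>_int[OF \<rho>2]])
              fix z
              show "indicator (sup_cball (\<rho> j)) (x - z) * \<sigma> z \<le> indicator (sup_cball (2 * \<rho> j)) (y - z) * \<sigma> z"
                using sup_cball_add[OF yx, of "x - z" "\<rho> j"] by (auto simp: indicator_def \<sigma>)
            qed
            then have "S (\<rho> j) x powr (p - 1) \<le> S (2 * \<rho> j) y powr (p - 1)"
              using p S_pos[OF \<rho>, of j x] by (intro powr_mono2) auto
            then have "c j x \<le> ?k * S (2 * \<rho> j) y powr (p - 1)"
              using b[of j] S_pos[OF \<rho>, of j x] by (simp add: c_def powr_mult)
            then show ?thesis using True y2 by (auto intro!: mult_right_mono ennreal_leI)
          qed simp
        qed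
        also have "\<dots> = ennreal (?k * S (2 * \<rho> j) y powr (p - 1)) * ennreal (\<integral>x. indicator (sup_cball (2 * \<rho> j)) (y - x) * w x \<partial>lborel)"
          using w_int[OF \<rho>2, of y] w0 by (simp add: nn_integral_cmult nn_integral_eq_integral)
        also have "\<dots> = ennreal (?k * ((\<integral>x. indicator (sup_cball (2 * \<rho> j)) (y - x) * w x \<partial>lborel) * S (2 * \<rho> j) y powr (p - 1)))"
          using k by (subst ennreal_mult''[symmetric]) (auto simp: w0 ac_simps intro!: Bochner_Integration.integral_nonneg)
        also have "\<dots> \<le> ennreal (C0 * (1 / 2) ^ j)"
        proof (rule ennreal_leI)
          have "?k * ((\<integral>x. indicator (sup_cball (2 * \<rho> j)) (y - x) * w x \<partial>lborel) * S (2 * \<rho> j) y powr (p - 1))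
            \<le> ?k * (\<bar>A\<bar> * (2 * \<rho> j) powr (CARD('n) * p))"
            using Ap[OF \<rho>2, of y] mult_right_mono[OF abs_ge_self[of A], of "(2 * \<rho> j) powr (CARD('n) * p)"]
            unfolding S_def[symmetric] by (intro mult_left_mono k) auto
          also have "\<dots> = C0 * 2 powr (real j * (2 * p - 1) - real j * (CARD('n) * p))"
          proof -
            have "?k = b j powr p * 2 powr (real j * (p - 1))"
            proof -
              have "b j * b j powr (p - 1) = b j powr p"
                using b[of j] powr_add[of "b j" 1 "p - 1"] by simp
              then show ?thesis by (simp add: powr_mult powr_powr mult.assoc mult.left_commute)
            qed
            also have "b j powr p = (2 / D) powr p * 2 powr (real j * p)"
              using D by (simp add: b_def powr_add powr_mult powr_divide powr_powr)
            finally have "?k = (2 / D) powr p * 2 powr (real j * (2 * p - 1))"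
              by (simp add: algebra_simps flip: powr_add)
            moreover have "(2 * \<rho> j) powr (CARD('n) * p) = (2 * D) powr (CARD('n) * p) * 2 powr (- (real j * (CARD('n) * p)))"
            proof -
              have "2 * \<rho> j = (2 * D) * 2 powr - real j" by (simp add: \<rho>_def)
              then show ?thesis using D by (simp only: powr_mult powr_powr) simp
            qed
            ultimately show ?thesis by (simp add: C0_def powr_diff powr_minus_divide)
          qed
          also have "\<dots> \<le> C0 * 2 powr (- real j)"
          proof -
            have "2 * p \<le> CARD('n) * p" using n p by (intro mult_right_mono) auto
            then have "real j * (2 * p) \<le> real j * (CARD('n) * p)" by (intro mult_left_mono) auto
            then show ?thesis using C0 by (intro mult_left_mono powr_mono) (auto simp: algebra_simps)
          qed
          also have "\<dots> = C0 * (1 / 2) ^ j" by (simp add: powr_minus_divide powr_realpow power_one_over)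
          finally show "?k * ((\<integral>x. indicator (sup_cball (2 * \<rho> j)) (y - x) * w x \<partial>lborel) * S (2 * \<rho> j) y powr (p - 1))
             \<le> C0 * (1 / 2) ^ j" .
        qed
        finally have "(\<integral>\<^sup>+x. ennreal (c j x) * ennreal (w x) * indicator (sup_cball (\<rho> j)) (x - y) \<partial>lborel) * F y
           \<le> ennreal (C0 * (1 / 2) ^ j) * F y" by (rule mult_right_mono) simp
        then show "(\<integral>\<^sup>+x. ennreal (c j x) * ennreal (w x) * indicator (sup_cball (\<rho> j)) (x - y) * F y \<partial>lborel)
           \<le> ennreal (C0 * (1 / 2) ^ j) * F y" by (simp add: nn_integral_multc)
      qed
      also have "\<dots> = ennreal (C0 * (1 / 2) ^ j) * (\<integral>\<^sup>+y. F y \<partial>lborel)" by (rule nn_integral_cmult) measurable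
      finally show "(\<integral>\<^sup>+x. ennreal (c j x) * J j x * ennreal (w x) \<partial>lborel)
         \<le> ennreal (C0 * (1 / 2) ^ j) * (\<integral>\<^sup>+y. F y \<partial>lborel)" .
    qed auto
    also have "\<dots> = ennreal (2 * C0) * (\<integral>\<^sup>+y. F y \<partial>lborel)"
      unfolding ennreal_suminf_multc suminf_ennreal_half[OF C0] ..
    finally have GF: "(\<integral>\<^sup>+x. G x * ennreal (w x) \<partial>lborel) \<le> ennreal (2 * C0) * (\<integral>\<^sup>+y. F y \<partial>lborel)" .
    have "ennreal (3 powr p) * (ennreal (2 * C0) * (\<integral>\<^sup>+y. F y \<partial>lborel)) = ennreal (3 powr p * (2 * C0)) * (\<integral>\<^sup>+y. F y \<partial>lborel)"
      using C0 by (simp add: ennreal_mult mult.assoc)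
    also have "\<dots> \<le> ennreal C * (\<integral>\<^sup>+y. F y \<partial>lborel)"
      by (rule mult_right_mono[OF ennreal_leI]) (simp_all add: C_def)
    finally show "(\<integral>\<^sup>+x. ennreal (h x powr p * w x) \<partial>lborel) \<le> ennreal C * (\<integral>\<^sup>+y. ennreal (f y powr p * w y) \<partial>lborel)"
      using order_trans[OF hG mult_left_mono[OF GF zero_le]] unfolding F_def by (rule order_trans[rotated])
  qed
qed

section \<open>Integration by parts across a point singularity\<close>

lemma integral_translate:
  fixes f :: "real^'n::finite \<Rightarrow> real"
  assumes [measurable]: "f \<in> borel_measurable borel"
  shows "integral\<^sup>L lborel (\<lambda>x. f (x + c)) = integral\<^sup>L lborel f"
    and "integrable lborel (\<lambda>x. f (x + c)) \<longleftrightarrow> integrable lborel f"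
proof -
  have "integral\<^sup>L lborel f = integral\<^sup>L (distr lborel borel ((+) c)) f"
    by (simp add: lborel_distr_plus)
  also have "\<dots> = integral\<^sup>L lborel (\<lambda>x. f (c + x))" by (rule integral_distr) auto
  finally show "integral\<^sup>L lborel (\<lambda>x. f (x + c)) = integral\<^sup>L lborel f" by (simp add: add.commute)
  have "integrable lborel f \<longleftrightarrow> integrable (distr lborel borel ((+) c)) f"
    by (simp add: lborel_distr_plus)
  also have "\<dots> \<longleftrightarrow> integrable lborel (\<lambda>x. f (c + x))" by (rule integrable_distr_eq) auto
  finally show "integrable lborel (\<lambda>x. f (x + c)) \<longleftrightarrow> integrable lborel f" by (simp add: add.commute)
qed

text \<open>Translation invariance gives \<open>\<integral> (F(x + e\<^sub>i) - F(x)) dx = 0\<close>. On every line that misses \<open>y\<close> the difference is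
the integral of \<open>H\<close> along a segment, and by Fubini's theorem the total is the integral of \<open>H\<close>. The one line that
passes through \<open>y\<close> is a null set because \<open>n \<ge> 2\<close>; thus the singularity causes no boundary term, whatever
the growth of \<open>F\<close>, as long as \<open>F\<close> and \<open>H\<close> are integrable.\<close>

lemma integral_directional_derivative_zero:
  fixes F H :: "real^'n::finite \<Rightarrow> real"
  assumes n: "2 \<le> CARD('n)" and F: "integrable lborel F" and H: "integrable lborel H"
    and deriv: "\<And>x. x \<noteq> y \<Longrightarrow> ((\<lambda>t. F (x + t *\<^sub>R axis i 1)) has_real_derivative H x) (at 0)"
  shows "integral\<^sup>L lborel H = 0"
proof -
  let ?e = "axis i (1::real) :: real^'n"
  have [measurable]: "F \<in> borel_measurable borel" "H \<in> borel_measurable borel" using F H by auto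
  obtain j where j: "j \<noteq> i"
  proof -
    have "UNIV \<noteq> {i}" using n by (metis card.empty card_insert_disjoint empty_iff finite.emptyI not_less_eq_eq numeral_2_eq_2 order_refl)
    then show ?thesis using that by blast
  qed
  have "negligible {x :: real^'n. x $ j = y $ j}" 
    using negligible_standard_hyperplane[of "axis j 1 :: real^'n" "y $ j"] by (simp add: inner_axis axis_in_Basis_iff)
  then have "AE x in lebesgue. x \<notin> {x :: real^'n. x $ j = y $ j}"
    by (intro AE_not_in) (simp add: negligible_iff_null_sets)
  then have off_line: "AE x in lborel. x $ j \<noteq> y $ j" by (simp add: AE_completion_iff)
  let ?P = "\<lambda>(s, x). indicator {0..1} s * H (x + s *\<^sub>R ?e)"
  have P: "integrable (lborel \<Otimes>\<^sub>M lborel) ?P"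
  proof (rule lborel_pair.Fubini_integrable)
    show "?P \<in> borel_measurable (lborel \<Otimes>\<^sub>M lborel)" by measurable
    have "(\<integral>x. \<bar>H (x + s *\<^sub>R ?e)\<bar> \<partial>lborel) = (\<integral>x. \<bar>H x\<bar> \<partial>lborel)" for s
      by (rule integral_translate(1)[of "\<lambda>x. \<bar>H x\<bar>"]) simp
    then show "integrable lborel (\<lambda>s. \<integral>x. norm (?P (s, x)) \<partial>lborel)"
      by (simp add: abs_mult integrable_real_indicator)
    show "AE s in lborel. integrable lborel (\<lambda>x. ?P (s, x))"
      using H by (intro AE_I2) (simp add: integral_translate(2))
  qed
  have FTC: "AE x in lborel. (\<integral>s. ?P (s, x) \<partial>lborel) = F (x + ?e) - F x"
    using off_line lborel_pair.AE_integrable_snd[OF P]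
  proof eventually_elim
    case (elim x)
    have ne: "x + s *\<^sub>R ?e \<noteq> y" for s
    proof -
      have "(x + s *\<^sub>R ?e) $ j = x $ j" using j by (simp add: axis_def)
      then show ?thesis using elim(1) by metis
    qed
    have "((\<lambda>t. F (x + t *\<^sub>R ?e)) has_real_derivative H (x + s *\<^sub>R ?e)) (at s)" for s
      using deriv[OF ne, of s] DERIV_at_within_shift[of "\<lambda>t. F (x + t *\<^sub>R ?e)" _ s 0 UNIV]
      by (simp add: algebra_simps)
    then have "((\<lambda>s. H (x + s *\<^sub>R ?e)) has_integral (F (x + 1 *\<^sub>R ?e) - F (x + 0 *\<^sub>R ?e))) {0..1}"
      by (intro fundamental_theorem_of_calculus)
         (auto simp: has_real_derivative_iff_has_vector_derivative[symmetric] intro: DERIV_subset)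
    then have "((\<lambda>s. ?P (s, x)) has_integral (F (x + ?e) - F x)) UNIV"
    proof -
      assume "((\<lambda>s. H (x + s *\<^sub>R ?e)) has_integral (F (x + 1 *\<^sub>R ?e) - F (x + 0 *\<^sub>R ?e))) {0..1}"
      then have "((\<lambda>s. if s \<in> {0..1} then H (x + s *\<^sub>R ?e) else 0) has_integral (F (x + ?e) - F x)) UNIV"
        by (simp only: has_integral_restrict_UNIV scaleR_one scaleR_zero_left add_0_right)
      moreover have "(\<lambda>s. ?P (s, x)) = (\<lambda>s. if s \<in> {0..1} then H (x + s *\<^sub>R ?e) else 0)"
        by (auto simp: indicator_def)
      ultimately show ?thesis by (simp only:)
    qed
    moreover have "((\<lambda>s. ?P (s, x)) has_integral (\<integral>s. ?P (s, x) \<partial>lborel)) UNIV"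
      using elim(2) by (intro has_integral_integral_lborel) simp
    ultimately show ?case using has_integral_unique by blast
  qed
  have Fe: "integrable lborel (\<lambda>x. F (x + ?e))" using F by (simp add: integral_translate(2))
  have "0 = (\<integral>x. F (x + ?e) - F x \<partial>lborel)"
    using F Fe by (simp add: integral_translate(1))
  also have "\<dots> = (\<integral>x. (\<integral>s. ?P (s, x) \<partial>lborel) \<partial>lborel)"
    using FTC by (intro integral_cong_AE) auto
  also have "\<dots> = (\<integral>s. (\<integral>x. ?P (s, x) \<partial>lborel) \<partial>lborel)"
    using lborel_pair.Fubini_integral[OF P] by simp
  also have "\<dots> = (\<integral>s. indicator {0..1::real} s * integral\<^sup>L lborel H \<partial>lborel)"
    by (simp add: integral_translate(1))
  also have "\<dots> = integral\<^sup>L lborel H" by simp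
  finally show ?thesis by simp
qed

lemma integrable_mult_test_function:
  assumes "integrable lborel g" "\<phi> \<in> test_functions \<Omega>"
  shows "integrable lborel (\<lambda>x. g x * \<phi> x)"
proof -
  obtain M where M: "0 \<le> M" "\<And>x. \<bar>\<phi> x\<bar> \<le> M" using test_functions_bounded[OF assms(2)] by blast
  have [measurable]: "g \<in> borel_measurable borel" "\<phi> \<in> borel_measurable borel"
    using assms test_functions_measurable by auto
  show ?thesis
  proof (rule Bochner_Integration.integrable_bound)
    show "integrable lborel (\<lambda>x. M * g x)" using assms(1) by simp
    show "AE x in lborel. norm (g x * \<phi> x) \<le> norm (M * g x)"
      using M by (intro AE_I2) (simp add: abs_mult mult.commute[of _ M] mult.commute[of _ "\<bar>\<phi> _\<bar>"] mult_right_mono)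
  qed measurable
qed

lemma integral_by_parts_punctured:
  fixes v :: "real^'n::finite \<Rightarrow> real"
  assumes n: "2 \<le> CARD('n)" and \<Omega>: "open \<Omega>" and \<phi>: "\<phi> \<in> test_functions \<Omega>"
    and v: "\<And>x. x \<in> \<Omega> - {y} \<Longrightarrow> v differentiable (at x)"
    and int: "integrable lborel (\<lambda>x. indicator (\<Omega> - {y}) x * v x)"
    and int': "integrable lborel (\<lambda>x. indicator (\<Omega> - {y}) x * partial i v x)"
  shows "(\<integral>x. indicator (\<Omega> - {y}) x * v x * partial i \<phi> x \<partial>lborel)
       = - (\<integral>x. indicator (\<Omega> - {y}) x * partial i v x * \<phi> x \<partial>lborel)"
proof -
  let ?V = "\<lambda>x. indicator (\<Omega> - {y}) x * v x" and ?W = "\<lambda>x. indicator (\<Omega> - {y}) x * partial i v x"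
  let ?K = "closure {x. \<phi> x \<noteq> 0}"
  have I: "integrable lborel (\<lambda>x. ?V x * \<phi> x)" "integrable lborel (\<lambda>x. ?W x * \<phi> x)"
    "integrable lborel (\<lambda>x. ?V x * partial i \<phi> x)"
    using int int' \<phi> by (auto intro!: integrable_mult_test_function test_functions_partial)
  have op: "open (\<Omega> - {y})" using \<Omega> by (simp add: open_delete)
  have "integral\<^sup>L lborel (\<lambda>x. ?W x * \<phi> x + ?V x * partial i \<phi> x) = 0"
  proof (rule integral_directional_derivative_zero[OF n])
    show "integrable lborel (\<lambda>x. ?V x * \<phi> x)"
      "integrable lborel (\<lambda>x. ?W x * \<phi> x + ?V x * partial i \<phi> x)" using I by auto
    fix x assume x: "x \<noteq> y"
    show "((\<lambda>t. ?V (x + t *\<^sub>R axis i 1) * \<phi> (x + t *\<^sub>R axis i 1)) has_real_derivative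
        ?W x * \<phi> x + ?V x * partial i \<phi> x) (at 0)"
    proof (cases "x \<in> \<Omega>")
      case True
      then have x': "x \<in> \<Omega> - {y}" using x by simp
      have "\<phi> differentiable (at x)"
        using test_functions_smooth[OF \<phi>] by (simp add: smooth_on_differentiable)
      from DERIV_mult[OF has_partial[OF v[OF x']] has_partial[OF this], of i i]
      have "((\<lambda>t. v (x + t *\<^sub>R axis i 1) * \<phi> (x + t *\<^sub>R axis i 1)) has_real_derivative
        ?W x * \<phi> x + ?V x * partial i \<phi> x) (at 0)"
        using x' by (simp add: algebra_simps)
      moreover have "\<forall>\<^sub>F t in nhds (0::real). ?V (x + t *\<^sub>R axis i 1) * \<phi> (x + t *\<^sub>R axis i 1) =
          v (x + t *\<^sub>R axis i 1) * \<phi> (x + t *\<^sub>R axis i 1)"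
        using eventually_line_in_open[where i=i, OF op x'] by eventually_elim simp
      ultimately show ?thesis by (subst DERIV_cong_ev[OF refl _ refl])
    next
      case False
      then have "x \<in> - ?K" using \<phi> by (auto simp: test_functions_def)
      have "open (- ?K)" by (rule open_Compl) (rule closed_closure)
      from eventually_line_in_open[where i=i, OF this \<open>x \<in> - ?K\<close>]
      have "\<forall>\<^sub>F t in nhds (0::real). ?V (x + t *\<^sub>R axis i 1) * \<phi> (x + t *\<^sub>R axis i 1) = 0"
      proof eventually_elim
        case (elim t) then show ?case using closure_subset[of "{x. \<phi> x \<noteq> 0}"] by auto
      qed
      then have "((\<lambda>t. ?V (x + t *\<^sub>R axis i 1) * \<phi> (x + t *\<^sub>R axis i 1)) has_real_derivative 0) (at 0)"
        using DERIV_cong_ev[OF refl _ refl, of "\<lambda>t. ?V (x + t *\<^sub>R axis i 1) * \<phi> (x + t *\<^sub>R axis i 1)" "\<lambda>_. 0"]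
        by simp
      then show ?thesis using False by simp
    qed
  qed
  then show ?thesis using I by (simp add: mult.assoc)
qed

section \<open>Potentials of kernels with a weak point singularity\<close>

text \<open>The properties of the Green function on which the estimate rests: derivatives up to order \<open>k\<close> in \<open>x\<close>
are at most as singular as \<open>1 / |x - y|\<close>.\<close>

locale singular_kernel =
  fixes \<Omega> :: "(real^'n::finite) set" and R :: "real^'n \<Rightarrow> real^'n \<Rightarrow> real"
    and k :: nat and d B :: real
  assumes open_domain: "open \<Omega>" and dim: "2 \<le> CARD('n)"
    and kernel_measurable: "(\<lambda>(x, y). R x y) \<in> borel_measurable (restrict_space borel (\<Omega> \<times> \<Omega>))"
    and kernel_smooth: "\<And>y. y \<in> \<Omega> \<Longrightarrow> smooth_on (\<Omega> - {y}) (\<lambda>x. R x y)"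
    and d_pos: "0 < d" and B_nonneg: "0 \<le> B"
    and kernel_bound: "\<And>\<eta> x y. mi_order \<eta> \<le> k \<Longrightarrow> x \<in> \<Omega> \<Longrightarrow> y \<in> \<Omega> \<Longrightarrow> x \<noteq> y \<Longrightarrow>
        \<bar>mderiv \<eta> (\<lambda>z. R z y) x\<bar> \<le> B / norm (x - y)"
    and diameter: "\<And>x y. x \<in> \<Omega> \<Longrightarrow> y \<in> \<Omega> \<Longrightarrow> norm (x - y) \<le> d"
begin

text \<open>On the diagonal, where the classical derivative has an arbitrary value, and outside \<open>\<Omega> \<times> \<Omega>\<close> the kernel is set to
\<open>0\<close>, so that it is a Borel function on the whole space.\<close>

definition kernel_deriv :: "('n \<Rightarrow> nat) \<Rightarrow> real^'n \<Rightarrow> real^'n \<Rightarrow> real" where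
  "kernel_deriv \<eta> x y = (if x \<in> \<Omega> \<and> y \<in> \<Omega> \<and> x \<noteq> y then mderiv \<eta> (\<lambda>z. R z y) x else 0)"

definition off_diagonal :: "((real^'n) \<times> (real^'n)) set" where
  "off_diagonal = (\<Omega> \<times> \<Omega>) - {p. fst p = snd p}"

lemma off_diagonal_borel: "off_diagonal \<in> sets borel"
  unfolding off_diagonal_def
  using open_domain by (intro sets.Diff borel_open borel_closed open_Times closed_Collect_eq continuous_intros)

text \<open>By induction on the order: off the diagonal a partial derivative is the limit of difference quotients of the
kernel of the next lower order, which are jointly measurable.\<close>

lemma kernel_deriv_measurable_pair: "(\<lambda>p. kernel_deriv \<eta> (fst p) (snd p)) \<in> borel_measurable borel"
proof (induction "mi_order \<eta>" arbitrary: \<eta>)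
  case 0
  then have "mderiv \<eta> f = f" for f by (cases \<eta> rule: mderiv_cases) auto
  then have "(\<lambda>p. kernel_deriv \<eta> (fst p) (snd p)) =
      (\<lambda>p. indicator off_diagonal p * (indicator (\<Omega> \<times> \<Omega>) p *\<^sub>R (case p of (x, y) \<Rightarrow> R x y)))"
    by (auto simp: kernel_deriv_def off_diagonal_def indicator_def fun_eq_iff)
  moreover have "\<Omega> \<times> \<Omega> \<in> sets borel" using open_domain by (intro borel_open open_Times)
  then have "(\<lambda>p. indicator (\<Omega> \<times> \<Omega>) p *\<^sub>R (case p of (x, y) \<Rightarrow> R x y)) \<in> borel_measurable borel"
    using kernel_measurable by (subst (asm) borel_measurable_restrict_space_iff) auto
  ultimately show ?case
    using off_diagonal_borel by (simp only:) (intro borel_measurable_times borel_measurable_indicator)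
next
  case (Suc n)
  obtain i \<eta>' where \<eta>': "n = mi_order \<eta>'" "\<And>f. mderiv \<eta> f = partial i (mderiv \<eta>' f)"
    using Suc.hyps(2) by (cases \<eta> rule: mderiv_cases) auto
  let ?e = "axis i (1::real)" and ?h = "\<lambda>N. 1 / real (Suc N)"
  have IH: "(\<lambda>p. kernel_deriv \<eta>' (fst p) (snd p)) \<in> borel_measurable borel" by (rule Suc.hyps(1)[OF \<eta>'(1)])
  show ?case
  proof (rule borel_measurable_LIMSEQ_real)
    fix p :: "(real^'n) \<times> (real^'n)"
    obtain x y where p: "p = (x, y)" by (cases p)
    show "(\<lambda>N. indicator off_diagonal p * ((kernel_deriv \<eta>' (fst p + ?h N *\<^sub>R ?e) (snd p) - kernel_deriv \<eta>' (fst p) (snd p)) / ?h N))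
        \<longlonglongrightarrow> kernel_deriv \<eta> (fst p) (snd p)"
    proof (cases "p \<in> off_diagonal")
      case True
      then have xy: "x \<in> \<Omega> - {y}" "y \<in> \<Omega>" by (auto simp: p off_diagonal_def)
      let ?g = "mderiv \<eta>' (\<lambda>z. R z y)"
      have "?g differentiable (at x)"
        using smooth_on_differentiable[OF smooth_on_mderiv[OF kernel_smooth[OF xy(2)]] xy(1)] .
      from has_partial[OF this, of i]
      have "((\<lambda>t. (?g (x + t *\<^sub>R ?e) - ?g x) / t) \<longlongrightarrow> partial i ?g x) (at 0)"
        by (simp add: has_field_derivative_iff)
      moreover have h: "?h \<longlonglongrightarrow> 0" by (rule LIMSEQ_Suc[OF lim_1_over_n])
      then have "filterlim ?h (at 0) sequentially"
        by (auto simp: filterlim_at intro!: always_eventually)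
      ultimately have lim: "(\<lambda>N. (?g (x + ?h N *\<^sub>R ?e) - ?g x) / ?h N) \<longlonglongrightarrow> partial i ?g x"
        by (rule filterlim_compose)
      have "(\<lambda>N. x + ?h N *\<^sub>R ?e) \<longlonglongrightarrow> x + 0 *\<^sub>R ?e"
        by (intro tendsto_intros h)
      then have "\<forall>\<^sub>F N in sequentially. x + ?h N *\<^sub>R ?e \<in> \<Omega> - {y}"
        using xy(1) open_domain by (intro topological_tendstoD) (auto simp: open_delete)
      then have "\<forall>\<^sub>F N in sequentially. (?g (x + ?h N *\<^sub>R ?e) - ?g x) / ?h N =
          indicator off_diagonal p * ((kernel_deriv \<eta>' (fst p + ?h N *\<^sub>R ?e) (snd p) - kernel_deriv \<eta>' (fst p) (snd p)) / ?h N)"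
        by eventually_elim (use True xy in \<open>auto simp: p kernel_deriv_def\<close>)
      with lim have "(\<lambda>N. indicator off_diagonal p * ((kernel_deriv \<eta>' (fst p + ?h N *\<^sub>R ?e) (snd p) - kernel_deriv \<eta>' (fst p) (snd p)) / ?h N))
        \<longlonglongrightarrow> partial i ?g x" by (rule Lim_transform_eventually)
      then show ?thesis using xy by (simp add: p kernel_deriv_def \<eta>'(2))
    qed (auto simp: p off_diagonal_def kernel_deriv_def)
  next
    fix N
    have "(\<lambda>p :: (real^'n) \<times> (real^'n). (fst p + ?h N *\<^sub>R ?e, snd p)) \<in> borel_measurable borel"
      by (intro borel_measurable_continuous_onI continuous_intros)
    from measurable_compose[OF this IH]
    have "(\<lambda>p. kernel_deriv \<eta>' (fst p + ?h N *\<^sub>R ?e) (snd p)) \<in> borel_measurable borel" by simp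
    with IH off_diagonal_borel
    show "(\<lambda>p. indicator off_diagonal p * ((kernel_deriv \<eta>' (fst p + ?h N *\<^sub>R ?e) (snd p) - kernel_deriv \<eta>' (fst p) (snd p)) / ?h N))
       \<in> borel_measurable borel"
      by (intro borel_measurable_times borel_measurable_indicator borel_measurable_divide borel_measurable_diff) auto
  qed
qed

lemma kernel_deriv_measurable [measurable]:
  assumes "f \<in> borel_measurable M" "g \<in> borel_measurable M"
  shows "(\<lambda>x. kernel_deriv \<eta> (f x) (g x)) \<in> borel_measurable M"
  using measurable_compose[OF borel_measurable_Pair[OF assms] kernel_deriv_measurable_pair] by simp

lemma kernel_deriv_bound:
  assumes "mi_order \<eta> \<le> k"
  shows "ennreal \<bar>kernel_deriv \<eta> x y\<bar> \<le> ennreal B * dyadic_kernel d x y"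
proof (cases "x \<in> \<Omega> \<and> y \<in> \<Omega> \<and> x \<noteq> y")
  case True
  then have "ennreal \<bar>kernel_deriv \<eta> x y\<bar> \<le> ennreal (B * (1 / norm (x - y)))"
    using kernel_bound[OF assms, of x y] by (intro ennreal_leI) (simp add: kernel_deriv_def)
  also have "\<dots> = ennreal B * ennreal (1 / norm (x - y))"
    using B_nonneg by (intro ennreal_mult) simp_all
  also have "\<dots> \<le> ennreal B * dyadic_kernel d x y"
    using True diameter by (intro mult_left_mono inverse_norm_le_dyadic_kernel) auto
  finally show ?thesis .
qed (auto simp: kernel_deriv_def)

definition kernel_mass :: real where
  "kernel_mass = B * (2 * (2 / d * (2 * d) ^ CARD('n)))"

lemma nn_integral_kernel_deriv:
  assumes "mi_order \<eta> \<le> k"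
  shows "(\<integral>\<^sup>+x. ennreal \<bar>kernel_deriv \<eta> x y\<bar> \<partial>lborel) \<le> ennreal kernel_mass"
proof -
  have "(\<integral>\<^sup>+x. ennreal \<bar>kernel_deriv \<eta> x y\<bar> \<partial>lborel) \<le> (\<integral>\<^sup>+x. ennreal B * dyadic_kernel d y x \<partial>lborel)"
    using kernel_deriv_bound[OF assms] by (intro nn_integral_mono) (simp add: dyadic_kernel_commute)
  also have "\<dots> = ennreal B * (\<integral>\<^sup>+x. dyadic_kernel d y x \<partial>lborel)"
    by (rule nn_integral_cmult) measurable
  also have "\<dots> \<le> ennreal B * ennreal (2 * (2 / d * (2 * d) ^ CARD('n)))"
    using dim d_pos by (intro mult_left_mono nn_integral_dyadic_kernel) auto
  also have "\<dots> = ennreal kernel_mass"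
    unfolding kernel_mass_def using B_nonneg d_pos by (intro ennreal_mult[symmetric]) simp_all
  finally show ?thesis .
qed

lemma kernel_deriv_integrable:
  assumes "mi_order \<eta> \<le> k"
  shows "integrable lborel (\<lambda>x. kernel_deriv \<eta> x y)"
proof (rule integrableI_bounded)
  show "(\<integral>\<^sup>+x. ennreal (norm (kernel_deriv \<eta> x y)) \<partial>lborel) < \<infinity>"
    using le_less_trans[OF nn_integral_kernel_deriv[OF assms, of y] ennreal_less_top] by simp
qed measurable

text \<open>The weak derivatives of \<open>R(\<cdot>, y)\<close> on all of \<open>\<Omega>\<close> are its classical derivatives away from \<open>y\<close>: one
derivative at a time is moved across the pole, which creates no distribution supported at \<open>y\<close> since all the
functions involved are integrable.\<close>

lemma kernel_weak_derivative:
  assumes "mi_order \<eta> \<le> k" "\<phi> \<in> test_functions \<Omega>" "y \<in> \<Omega>"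
  shows "(\<integral>x. kernel_deriv (\<lambda>_. 0) x y * mderiv \<eta> \<phi> x \<partial>lborel) =
     (- 1) ^ mi_order \<eta> * (\<integral>x. kernel_deriv \<eta> x y * \<phi> x \<partial>lborel)"
  using assms(1,2)
proof (induction "mi_order \<eta>" arbitrary: \<eta> \<phi>)
  case 0
  then have a: "mderiv \<eta> f = f" for f by (cases \<eta> rule: mderiv_cases) auto
  have b: "mderiv (\<lambda>_. 0) f = f" for f :: "real^'n \<Rightarrow> real"
    by (cases "\<lambda>_::'n. 0::nat" rule: mderiv_cases) (auto simp: mi_order_def)
  have "kernel_deriv (\<lambda>_. 0) = kernel_deriv \<eta>"
    by (intro ext) (simp only: kernel_deriv_def a b)
  then show ?case using 0(1)[symmetric] by (simp add: a)
next
  case (Suc n)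
  obtain i \<eta>' where \<eta>': "n = mi_order \<eta>'" "\<And>f. mderiv \<eta> f = partial i (mderiv \<eta>' f)"
    using Suc.hyps(2) by (cases \<eta> rule: mderiv_cases) auto
  have k: "mi_order \<eta>' \<le> k" using Suc \<eta>' by simp
  let ?v = "mderiv \<eta>' (\<lambda>z. R z y)"
  have eq: "kernel_deriv \<eta>' x y = indicator (\<Omega> - {y}) x * ?v x"
    "kernel_deriv \<eta> x y = indicator (\<Omega> - {y}) x * partial i ?v x" for x
    using assms(3) by (auto simp: kernel_deriv_def indicator_def \<eta>'(2))
  have "mderiv \<eta> \<phi> = mderiv \<eta>' (partial i \<phi>)"
    using Suc.prems(2) by (simp add: \<eta>'(2) partial_mderiv_commute test_functions_smooth)
  then have "(\<integral>x. kernel_deriv (\<lambda>_. 0) x y * mderiv \<eta> \<phi> x \<partial>lborel) =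
      (- 1) ^ mi_order \<eta>' * (\<integral>x. kernel_deriv \<eta>' x y * partial i \<phi> x \<partial>lborel)"
    using Suc.hyps(1)[OF \<eta>'(1) k test_functions_partial[OF Suc.prems(2), of i]] by simp
  also have "(\<integral>x. kernel_deriv \<eta>' x y * partial i \<phi> x \<partial>lborel) = - (\<integral>x. kernel_deriv \<eta> x y * \<phi> x \<partial>lborel)"
    unfolding eq
  proof (rule integral_by_parts_punctured[OF dim open_domain Suc.prems(2)])
    show "?v differentiable at x" if "x \<in> \<Omega> - {y}" for x
      using smooth_on_differentiable[OF smooth_on_mderiv[OF kernel_smooth[OF assms(3)]] that] .
    show "integrable lborel (\<lambda>x. indicator (\<Omega> - {y}) x * ?v x)"
      using kernel_deriv_integrable[OF k, of y] by (simp add: eq)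
    show "integrable lborel (\<lambda>x. indicator (\<Omega> - {y}) x * partial i ?v x)"
      using kernel_deriv_integrable[OF Suc.prems(1), of y] by (simp add: eq)
  qed
  moreover have "mi_order \<eta> = Suc (mi_order \<eta>')" using Suc.hyps(2) \<eta>'(1) by simp
  ultimately show ?case by simp
qed

definition potential :: "('n \<Rightarrow> nat) \<Rightarrow> (real^'n \<Rightarrow> real) \<Rightarrow> real^'n \<Rightarrow> real" where
  "potential \<eta> f x = (\<integral>y. kernel_deriv \<eta> x y * f y \<partial>lborel)"

text \<open>The hypothesis of Fubini's theorem: the mass of the kernel in \<open>x\<close> is bounded uniformly in \<open>y\<close>. The factor
\<open>\<psi>\<close> will be a test function, or \<open>1\<close> to see that the potential itself is integrable.\<close>

lemma potential_pair_integrable: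
  assumes \<eta>: "mi_order \<eta> \<le> k" and f: "integrable lborel f"
    and [measurable]: "\<psi> \<in> borel_measurable borel" and M: "0 \<le> M" "\<And>x. \<bar>\<psi> x\<bar> \<le> M"
  shows "integrable (lborel \<Otimes>\<^sub>M lborel) (\<lambda>(x, y). kernel_deriv \<eta> x y * f y * \<psi> x)"
proof (rule integrableI_bounded)
  have [measurable]: "f \<in> borel_measurable borel" using f by auto
  show "(\<lambda>(x, y). kernel_deriv \<eta> x y * f y * \<psi> x) \<in> borel_measurable (lborel \<Otimes>\<^sub>M lborel)" by measurable
  have "(\<integral>\<^sup>+p. ennreal (norm (case p of (x, y) \<Rightarrow> kernel_deriv \<eta> x y * f y * \<psi> x)) \<partial>(lborel \<Otimes>\<^sub>M lborel))
     = (\<integral>\<^sup>+y. (\<integral>\<^sup>+x. ennreal (norm (kernel_deriv \<eta> x y * f y * \<psi> x)) \<partial>lborel) \<partial>lborel)"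
    by (subst lborel_pair.nn_integral_snd[symmetric]) simp_all
  also have "\<dots> \<le> (\<integral>\<^sup>+y. ennreal M * ennreal kernel_mass * ennreal \<bar>f y\<bar> \<partial>lborel)"
  proof (rule nn_integral_mono)
    fix y
    have "(\<integral>\<^sup>+x. ennreal (norm (kernel_deriv \<eta> x y * f y * \<psi> x)) \<partial>lborel)
       \<le> (\<integral>\<^sup>+x. (ennreal M * ennreal \<bar>f y\<bar>) * ennreal \<bar>kernel_deriv \<eta> x y\<bar> \<partial>lborel)"
    proof (rule nn_integral_mono)
      fix x
      have "norm (kernel_deriv \<eta> x y * f y * \<psi> x) \<le> M * \<bar>f y\<bar> * \<bar>kernel_deriv \<eta> x y\<bar>"
        using mult_left_mono[OF M(2)[of x], of "\<bar>f y\<bar> * \<bar>kernel_deriv \<eta> x y\<bar>"] by (simp add: abs_mult ac_simps)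
      then have "ennreal (norm (kernel_deriv \<eta> x y * f y * \<psi> x)) \<le> ennreal (M * \<bar>f y\<bar> * \<bar>kernel_deriv \<eta> x y\<bar>)"
        by (rule ennreal_leI)
      also have "\<dots> = (ennreal M * ennreal \<bar>f y\<bar>) * ennreal \<bar>kernel_deriv \<eta> x y\<bar>"
        using M(1) by (simp add: ennreal_mult)
      finally show "ennreal (norm (kernel_deriv \<eta> x y * f y * \<psi> x)) \<le> \<dots>" .
    qed
    also have "\<dots> = (ennreal M * ennreal \<bar>f y\<bar>) * (\<integral>\<^sup>+x. ennreal \<bar>kernel_deriv \<eta> x y\<bar> \<partial>lborel)"
      by (rule nn_integral_cmult) measurable
    also have "\<dots> \<le> (ennreal M * ennreal \<bar>f y\<bar>) * ennreal kernel_mass"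
      by (intro mult_left_mono nn_integral_kernel_deriv \<eta>) simp
    finally show "(\<integral>\<^sup>+x. ennreal (norm (kernel_deriv \<eta> x y * f y * \<psi> x)) \<partial>lborel)
       \<le> ennreal M * ennreal kernel_mass * ennreal \<bar>f y\<bar>" by (simp only: ac_simps)
  qed
  also have "\<dots> = ennreal M * ennreal kernel_mass * (\<integral>\<^sup>+y. ennreal \<bar>f y\<bar> \<partial>lborel)"
    by (rule nn_integral_cmult) measurable
  also have "\<dots> < \<infinity>"
    using f by (auto simp: integrable_iff_bounded ennreal_mult_less_top)
  finally show "(\<integral>\<^sup>+p. ennreal (norm (case p of (x, y) \<Rightarrow> kernel_deriv \<eta> x y * f y * \<psi> x)) \<partial>(lborel \<Otimes>\<^sub>M lborel)) < \<infinity>" .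
qed

lemma potential_integrable:
  assumes "mi_order \<eta> \<le> k" "integrable lborel f"
  shows "integrable lborel (potential \<eta> f)" "AE x in lborel. integrable lborel (\<lambda>y. kernel_deriv \<eta> x y * f y)"
  using lborel_pair.integrable_fst[OF potential_pair_integrable[OF assms, of "\<lambda>_. 1" 1]]
    lborel_pair.AE_integrable_fst[OF potential_pair_integrable[OF assms, of "\<lambda>_. 1" 1]]
  unfolding potential_def by simp_all

lemma potential_weak_derivative:
  assumes \<eta>: "mi_order \<eta> \<le> k" and f: "integrable lborel f" and \<phi>: "\<phi> \<in> test_functions \<Omega>"
  shows "(\<integral>x. potential (\<lambda>_. 0) f x * mderiv \<eta> \<phi> x \<partial>lborel) =
     (- 1) ^ mi_order \<eta> * (\<integral>x. potential \<eta> f x * \<phi> x \<partial>lborel)"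
proof -
  have swap: "(\<integral>x. potential \<theta> f x * \<psi> x \<partial>lborel) = (\<integral>y. f y * (\<integral>x. kernel_deriv \<theta> x y * \<psi> x \<partial>lborel) \<partial>lborel)"
    if \<theta>: "mi_order \<theta> \<le> k" and \<psi>: "\<psi> \<in> test_functions \<Omega>" for \<theta> \<psi>
  proof -
    obtain M where M: "0 \<le> M" "\<And>x. \<bar>\<psi> x\<bar> \<le> M" using test_functions_bounded[OF \<psi>] by blast
    have "(\<integral>x. potential \<theta> f x * \<psi> x \<partial>lborel) = (\<integral>x. (\<integral>y. kernel_deriv \<theta> x y * f y * \<psi> x \<partial>lborel) \<partial>lborel)"
      by (simp add: potential_def)
    also have "\<dots> = (\<integral>y. (\<integral>x. kernel_deriv \<theta> x y * f y * \<psi> x \<partial>lborel) \<partial>lborel)"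
      by (rule lborel_pair.Fubini_integral[symmetric])
         (rule potential_pair_integrable[OF \<theta> f test_functions_measurable[OF \<psi>] M])
    also have "\<dots> = (\<integral>y. (\<integral>x. f y * (kernel_deriv \<theta> x y * \<psi> x) \<partial>lborel) \<partial>lborel)"
      by (simp only: ac_simps)
    finally show ?thesis by simp
  qed
  have "(\<integral>x. potential (\<lambda>_. 0) f x * mderiv \<eta> \<phi> x \<partial>lborel) =
      (\<integral>y. f y * (\<integral>x. kernel_deriv (\<lambda>_. 0) x y * mderiv \<eta> \<phi> x \<partial>lborel) \<partial>lborel)"
    using \<phi> by (intro swap test_functions_mderiv) (simp add: mi_order_def)
  also have "\<dots> = (\<integral>y. (- 1) ^ mi_order \<eta> * (f y * (\<integral>x. kernel_deriv \<eta> x y * \<phi> x \<partial>lborel)) \<partial>lborel)"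
  proof (rule Bochner_Integration.integral_cong[OF refl])
    fix y
    show "f y * (\<integral>x. kernel_deriv (\<lambda>_. 0) x y * mderiv \<eta> \<phi> x \<partial>lborel) =
        (- 1) ^ mi_order \<eta> * (f y * (\<integral>x. kernel_deriv \<eta> x y * \<phi> x \<partial>lborel))"
    proof (cases "y \<in> \<Omega>")
      case True then show ?thesis by (simp add: kernel_weak_derivative[OF \<eta> \<phi>])
    qed (simp add: kernel_deriv_def)
  qed
  also have "\<dots> = (- 1) ^ mi_order \<eta> * (\<integral>x. potential \<eta> f x * \<phi> x \<partial>lborel)"
    by (simp add: swap[OF \<eta> \<phi>])
  finally show ?thesis .
qed

lemma potential_bound:
  assumes "mi_order \<eta> \<le> k" and [measurable]: "f \<in> borel_measurable borel"
  shows "ennreal \<bar>potential \<eta> f x\<bar> \<le> (\<integral>\<^sup>+y. dyadic_kernel d x y * ennreal (B * \<bar>f y\<bar>) \<partial>lborel)"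
proof -
  have "ennreal \<bar>potential \<eta> f x\<bar> \<le> (\<integral>\<^sup>+y. ennreal (norm (kernel_deriv \<eta> x y * f y)) \<partial>lborel)"
  proof (cases "integrable lborel (\<lambda>y. kernel_deriv \<eta> x y * f y)")
    case True
    then show ?thesis using integral_norm_bound_ennreal[OF True] by (simp add: potential_def)
  qed (simp add: potential_def not_integrable_integral_eq)
  also have "\<dots> \<le> (\<integral>\<^sup>+y. dyadic_kernel d x y * ennreal (B * \<bar>f y\<bar>) \<partial>lborel)"
  proof (rule nn_integral_mono)
    fix y
    have "ennreal (norm (kernel_deriv \<eta> x y * f y)) = ennreal \<bar>kernel_deriv \<eta> x y\<bar> * ennreal \<bar>f y\<bar>"
      by (simp add: abs_mult ennreal_mult)
    also have "\<dots> \<le> ennreal B * dyadic_kernel d x y * ennreal \<bar>f y\<bar>"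
      by (intro mult_right_mono kernel_deriv_bound assms) simp
    also have "\<dots> = dyadic_kernel d x y * ennreal (B * \<bar>f y\<bar>)"
      using B_nonneg by (simp add: ennreal_mult ac_simps)
    finally show "ennreal (norm (kernel_deriv \<eta> x y * f y)) \<le> dyadic_kernel d x y * ennreal (B * \<bar>f y\<bar>)" .
  qed
  finally show ?thesis .
qed

end

section \<open>Lebesgue and Borel measurable representatives\<close>

text \<open>Tonelli's theorem is applied to the product of two Borel measures, whereas the function spaces
are formed with Lebesgue measurable functions on a set. The passage between the two rests on the completeness of
Lebesgue measure and on Borel functions that agree almost everywhere with the given ones.\<close>

lemma integral_lebesgue_on_eq_lborel:
  fixes h :: "real^'n::finite \<Rightarrow> real"
  assumes \<Omega>: "\<Omega> \<in> sets borel" and [measurable]: "h \<in> borel_measurable borel" and "\<And>x. x \<notin> \<Omega> \<Longrightarrow> h x = 0"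
  shows "integral\<^sup>L (lebesgue_on \<Omega>) h = integral\<^sup>L lborel h"
    and "integrable (lebesgue_on \<Omega>) h \<longleftrightarrow> integrable lborel h"
proof -
  have eq: "(\<lambda>x. indicator \<Omega> x *\<^sub>R h x) = h" using assms(3) by (auto simp: indicator_def fun_eq_iff)
  have "\<Omega> \<inter> space lebesgue \<in> sets lebesgue" using \<Omega> by auto
  then show "integral\<^sup>L (lebesgue_on \<Omega>) h = integral\<^sup>L lborel h"
    "integrable (lebesgue_on \<Omega>) h \<longleftrightarrow> integrable lborel h"
    using eq by (simp_all add: integral_restrict_space integrable_restrict_space integral_completion integrable_completion)
qed

lemma AE_eq_measurable_lebesgue:
  fixes f g :: "'a::euclidean_space \<Rightarrow> real"
  assumes g: "g \<in> borel_measurable lebesgue" and ae: "AE x in lebesgue. f x = g x"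
  shows "f \<in> borel_measurable lebesgue"
proof (rule measurableI)
  fix A :: "real set" assume "A \<in> sets borel"
  then have "g -` A \<inter> space lebesgue \<in> sets lebesgue" using g by (rule measurable_sets[rotated])
  moreover have "AE x in lebesgue. x \<in> g -` A \<inter> space lebesgue \<longleftrightarrow> x \<in> f -` A \<inter> space lebesgue"
    using ae by eventually_elim auto
  ultimately show "f -` A \<inter> space lebesgue \<in> sets lebesgue"
    using complete_measure.in_sets_AE[OF completion.complete_measure_axioms] by blast
qed auto

lemma AE_eq_measurable_lebesgue_on:
  fixes f g :: "'a::euclidean_space \<Rightarrow> real"
  assumes \<Omega>: "\<Omega> \<in> sets borel" and g: "g \<in> borel_measurable borel" and ae: "AE x in lebesgue_on \<Omega>. f x = g x"
  shows "f \<in> borel_measurable (lebesgue_on \<Omega>)"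
proof -
  have \<Omega>': "\<Omega> \<inter> space lebesgue \<in> sets lebesgue" using \<Omega> by auto
  have "AE x in lebesgue. x \<in> \<Omega> \<longrightarrow> f x = g x" using ae \<Omega>' by (simp add: AE_restrict_space_iff)
  then have "AE x in lebesgue. indicator \<Omega> x *\<^sub>R f x = indicator \<Omega> x *\<^sub>R g x"
    by eventually_elim (auto simp: indicator_def)
  moreover have "(\<lambda>x. indicator \<Omega> x *\<^sub>R g x) \<in> borel_measurable lebesgue"
    using \<Omega> g by (intro measurable_completion) simp
  ultimately have "(\<lambda>x. indicator \<Omega> x *\<^sub>R f x) \<in> borel_measurable lebesgue"
    by (rule AE_eq_measurable_lebesgue[rotated])
  then show ?thesis by (simp only: borel_measurable_restrict_space_iff[OF \<Omega>'])
qed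

lemma has_weak_derivI:
  fixes g g' v :: "real^'n::finite \<Rightarrow> real"
  assumes \<Omega>: "open \<Omega>" and g: "integrable lborel g" and g': "integrable lborel g'"
    and v: "AE x in lebesgue_on \<Omega>. v x = g x"
    and parts: "\<And>\<phi>. \<phi> \<in> test_functions \<Omega> \<Longrightarrow>
       (\<integral>x. g x * mderiv \<eta> \<phi> x \<partial>lborel) = (- 1) ^ mi_order \<eta> * (\<integral>x. g' x * \<phi> x \<partial>lborel)"
  shows "has_weak_deriv \<Omega> \<eta> v g'"
proof -
  have \<Omega>b: "\<Omega> \<in> sets borel" and \<Omega>l: "\<Omega> \<inter> space lebesgue \<in> sets lebesgue" using \<Omega> by auto
  have gm[measurable]: "g \<in> borel_measurable borel" "g' \<in> borel_measurable borel" using g g' by auto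
  have vm: "v \<in> borel_measurable (lebesgue_on \<Omega>)" using \<Omega>b gm(1) v by (rule AE_eq_measurable_lebesgue_on)
  have loc: "integrable (lebesgue_on K) h" if "integrable (lebesgue_on \<Omega>) h" "compact K" "K \<subseteq> \<Omega>"
    for K and h :: "real^'n \<Rightarrow> real"
  proof -
    have "integrable lebesgue (\<lambda>x. indicator \<Omega> x *\<^sub>R h x)"
      using that(1) \<Omega>l by (simp add: integrable_restrict_space)
    moreover have K: "K \<in> sets lebesgue" using that(2) by (simp add: compact_imp_closed)
    ultimately have "integrable lebesgue (\<lambda>x. indicator K x *\<^sub>R (indicator \<Omega> x *\<^sub>R h x))"
      by (rule integrable_mult_indicator[rotated])
    also have "(\<lambda>x. indicator K x *\<^sub>R (indicator \<Omega> x *\<^sub>R h x)) = (\<lambda>x. indicator K x *\<^sub>R h x)"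
      using that(3) by (auto simp: indicator_def fun_eq_iff)
    finally show ?thesis using K by (simp add: integrable_restrict_space)
  qed
  have int: "integrable (lebesgue_on \<Omega>) h" if "integrable lborel h" for h :: "real^'n \<Rightarrow> real"
  proof -
    have "integrable lebesgue h" using that integrable_completion[of h lborel] by auto
    then have "integrable lebesgue (\<lambda>x. indicator \<Omega> x *\<^sub>R h x)"
      using \<Omega>l by (intro integrable_mult_indicator[where A=\<Omega>]) auto
    then show ?thesis using \<Omega>l by (simp add: integrable_restrict_space)
  qed
  have vint: "integrable (lebesgue_on \<Omega>) v"
    by (rule integrable_cong_AE_imp[OF int[OF g] vm]) (use v in eventually_elim, simp)
  have test0: "\<psi> x = 0" if "\<psi> \<in> test_functions \<Omega>" "x \<notin> \<Omega>" for \<psi> x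
    using that closure_subset[of "{x. \<psi> x \<noteq> 0}"] by (auto simp: test_functions_def)
  have "integral\<^sup>L (lebesgue_on \<Omega>) (\<lambda>x. v x * mderiv \<eta> \<phi> x) =
      (- 1) ^ mi_order \<eta> * integral\<^sup>L (lebesgue_on \<Omega>) (\<lambda>x. g' x * \<phi> x)" if \<phi>: "\<phi> \<in> test_functions \<Omega>" for \<phi>
  proof -
    note \<psi> = test_functions_mderiv[OF \<phi>, of \<eta>]
    have [measurable]: "\<phi> \<in> borel_measurable borel" "mderiv \<eta> \<phi> \<in> borel_measurable borel"
      using test_functions_measurable[OF \<phi>] test_functions_measurable[OF \<psi>] by auto
    have "integral\<^sup>L (lebesgue_on \<Omega>) (\<lambda>x. v x * mderiv \<eta> \<phi> x) = integral\<^sup>L (lebesgue_on \<Omega>) (\<lambda>x. g x * mderiv \<eta> \<phi> x)"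
    proof (rule integral_cong_AE)
      have "AE x in lebesgue_on \<Omega>. v x * mderiv \<eta> \<phi> x = g x * mderiv \<eta> \<phi> x"
        using v by eventually_elim simp
      then show "(\<lambda>x. v x * mderiv \<eta> \<phi> x) \<in> borel_measurable (lebesgue_on \<Omega>)"
        "AE x in lebesgue_on \<Omega>. v x * mderiv \<eta> \<phi> x = g x * mderiv \<eta> \<phi> x"
        using AE_eq_measurable_lebesgue_on[OF \<Omega>b, of "\<lambda>x. g x * mderiv \<eta> \<phi> x"] by auto
      show "(\<lambda>x. g x * mderiv \<eta> \<phi> x) \<in> borel_measurable (lebesgue_on \<Omega>)"
        by (rule AE_eq_measurable_lebesgue_on[OF \<Omega>b, of "\<lambda>x. g x * mderiv \<eta> \<phi> x"]) auto
    qed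
    also have "\<dots> = (\<integral>x. g x * mderiv \<eta> \<phi> x \<partial>lborel)"
      by (rule integral_lebesgue_on_eq_lborel[OF \<Omega>b]) (use test0[OF \<psi>] in auto)
    also have "\<dots> = (- 1) ^ mi_order \<eta> * (\<integral>x. g' x * \<phi> x \<partial>lborel)" by (rule parts[OF \<phi>])
    also have "(\<integral>x. g' x * \<phi> x \<partial>lborel) = integral\<^sup>L (lebesgue_on \<Omega>) (\<lambda>x. g' x * \<phi> x)"
      by (rule integral_lebesgue_on_eq_lborel(1)[OF \<Omega>b, symmetric]) (use test0[OF \<phi>] in auto)
    finally show ?thesis .
  qed
  then show ?thesis
    unfolding has_weak_deriv_def locally_integrable_def using loc vint int[OF g'] by auto
qed

section \<open>Muckenhoupt weights and the Green potential\<close>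

text \<open>For orders up to \<open>max_order\<close> the exponent \<open>s = 2 m - n - |\<eta>|\<close> is at least \<open>-1\<close>: it is at least \<open>m - n / 2 - 1 / 2\<close> for odd
\<open>n \<le> 2 m + 1\<close> and at least \<open>m - n / 2\<close> for even \<open>n \<le> 2 m\<close>. Distances in \<open>\<Omega>\<close> are bounded, so \<open>1\<close>,
\<open>|ln r|\<close> and \<open>r\<^sup>s\<close> are all dominated by a multiple of \<open>1 / r\<close>.\<close>

lemma green_kernel_bound:
  fixes R :: "real^'n::finite \<Rightarrow> real^'n \<Rightarrow> real"
  assumes est: "green_estimate \<Omega> m R" and k: "real k \<le> max_order CARD('n) m"
    and n: "(odd CARD('n) \<and> CARD('n) \<le> 2 * m + 1) \<or> (even CARD('n) \<and> CARD('n) \<le> 2 * m)"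
    and d: "1 \<le> d" "\<And>x y. x \<in> \<Omega> \<Longrightarrow> y \<in> \<Omega> \<Longrightarrow> norm (x - y) \<le> d"
  obtains B where "0 \<le> B" "\<And>\<eta> x y. mi_order \<eta> \<le> k \<Longrightarrow> x \<in> \<Omega> \<Longrightarrow> y \<in> \<Omega> \<Longrightarrow> x \<noteq> y \<Longrightarrow>
        \<bar>mderiv \<eta> (\<lambda>z. R z y) x\<bar> \<le> B / norm (x - y)"
proof -
  obtain C where C: "\<And>\<eta> x y. real (mi_order \<eta>) \<le> max_order CARD('n) m \<Longrightarrow> x \<in> \<Omega> \<Longrightarrow> y \<in> \<Omega> \<Longrightarrow> x \<noteq> y \<Longrightarrow>
       \<bar>mderiv \<eta> (\<lambda>z. R z y) x\<bar> \<le> C * (1 + \<bar>ln (norm (x - y))\<bar> +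
         norm (x - y) powr (2 * real m - real CARD('n) - real (mi_order \<eta>)))"
    using est unfolding green_estimate_def by blast
  define B where "B = \<bar>C\<bar> * (d + (d\<^sup>2 + 1) + d powr (2 * real m + 1))"
  show ?thesis
  proof (rule that[of B])
    show "0 \<le> B" using d by (auto simp: B_def intro!: mult_nonneg_nonneg add_nonneg_nonneg)
    fix \<eta> :: "'n \<Rightarrow> nat" and x y assume \<eta>: "mi_order \<eta> \<le> k" and xy: "x \<in> \<Omega>" "y \<in> \<Omega>" "x \<noteq> y"
    define r s where "r = norm (x - y)" and "s = 2 * real m - real CARD('n) - real (mi_order \<eta>)"
    have r: "0 < r" "r \<le> d" using xy d by (auto simp: r_def)
    have \<eta>': "real (mi_order \<eta>) \<le> max_order CARD('n) m" using \<eta> k by linarith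
    have s: "0 \<le> s + 1" "s + 1 \<le> 2 * real m + 1"
      using \<eta>' n by (auto simp: max_order_def s_def split: if_splits)
    have "1 \<le> d / r" using r by simp
    moreover have "\<bar>ln r\<bar> \<le> (d\<^sup>2 + 1) / r"
    proof -
      have "ln r \<le> r" using ln_le_minus_one[OF r(1)] by linarith
      also have "r \<le> d\<^sup>2 / r" using r power_mono[OF r(2), of 2] by (simp add: field_simps power2_eq_square)
      also have "\<dots> \<le> (d\<^sup>2 + 1) / r" using r by (simp add: divide_right_mono)
      finally have 1: "ln r \<le> (d\<^sup>2 + 1) / r" .
      have "- ln r = ln (1 / r)" using r by (simp add: ln_div)
      also have "\<dots> \<le> 1 / r" using ln_le_minus_one[of "1 / r"] r by simp
      also have "\<dots> \<le> (d\<^sup>2 + 1) / r" using r by (simp add: divide_right_mono)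
      finally show ?thesis using 1 by linarith
    qed
    moreover have "r powr s \<le> d powr (2 * real m + 1) / r"
    proof -
      have "r powr s = r powr (s + 1) / r" using r by (simp add: powr_add)
      also have "\<dots> \<le> d powr (s + 1) / r"
        using r s by (intro divide_right_mono powr_mono2) auto
      also have "\<dots> \<le> d powr (2 * real m + 1) / r"
        using r s d by (intro divide_right_mono powr_mono) auto
      finally show ?thesis .
    qed
    ultimately have "1 + \<bar>ln r\<bar> + r powr s \<le> (d + (d\<^sup>2 + 1) + d powr (2 * real m + 1)) / r"
      by (simp add: add_divide_distrib)
    then have "\<bar>C\<bar> * (1 + \<bar>ln r\<bar> + r powr s) \<le> B / r"
      unfolding B_def times_divide_eq_right[symmetric] by (rule mult_left_mono) simp
    moreover have "C * (1 + \<bar>ln r\<bar> + r powr s) \<le> \<bar>C\<bar> * (1 + \<bar>ln r\<bar> + r powr s)"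
      by (intro mult_right_mono) auto
    ultimately show "\<bar>mderiv \<eta> (\<lambda>z. R z y) x\<bar> \<le> B / norm (x - y)"
      using C[OF \<eta>' xy] by (simp add: r_def s_def)
  qed
qed

lemma integral_borel_representative:
  fixes g h :: "real^'n::finite \<Rightarrow> real"
  assumes Q: "Q \<in> sets borel" and [measurable]: "g \<in> borel_measurable borel"
    and ae: "AE x in lebesgue_on Q. h x = g x"
  shows "integrable (lebesgue_on Q) h \<longleftrightarrow> integrable lborel (\<lambda>x. indicator Q x * g x)"
    and "integral\<^sup>L (lebesgue_on Q) h = integral\<^sup>L lborel (\<lambda>x. indicator Q x * g x)"
proof -
  note [measurable] = Q
  let ?g = "\<lambda>x. indicator Q x * g x"
  have gm: "?g \<in> borel_measurable borel" by measurable
  have "Q \<inter> space lebesgue \<in> sets lebesgue" using Q by auto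
  then have "AE x in lebesgue_on Q. x \<in> Q" by (simp add: AE_restrict_space_iff)
  with ae have ae': "AE x in lebesgue_on Q. h x = ?g x" by eventually_elim simp
  then have hm: "h \<in> borel_measurable (lebesgue_on Q)"
    by (rule AE_eq_measurable_lebesgue_on[OF Q gm])
  have gm': "?g \<in> borel_measurable (lebesgue_on Q)"
    by (rule AE_eq_measurable_lebesgue_on[OF Q gm]) simp
  show "integrable (lebesgue_on Q) h \<longleftrightarrow> integrable lborel ?g"
    using integrable_cong_AE[OF hm gm' ae'] integral_lebesgue_on_eq_lborel(2)[OF Q gm] by simp
  show "integral\<^sup>L (lebesgue_on Q) h = integral\<^sup>L lborel ?g"
    using integral_cong_AE[OF hm gm' ae'] integral_lebesgue_on_eq_lborel(1)[OF Q gm] by simp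
qed

lemma AE_lebesgue_on_if_AE_lborel:
  assumes "\<Omega> \<in> sets borel" "AE x in lborel. P x"
  shows "AE x in lebesgue_on \<Omega>. P x"
proof -
  have "\<Omega> \<inter> space lebesgue \<in> sets lebesgue" using assms by auto
  then show ?thesis using AE_completion[OF assms(2)] by (auto simp: AE_restrict_space_iff)
qed

text \<open>The Muckenhoupt condition in the form used by the dyadic estimate: integrals instead of averages, over the cubes
centred at \<open>x\<close>, whose side is \<open>2 \<rho>\<close>.\<close>

lemma muckenhoupt_borel_representative:
  fixes w :: "real^'n::finite \<Rightarrow> real" and p :: real
  assumes w: "muckenhoupt p w" and p: "1 < p"
  obtains v A where "v \<in> borel_measurable borel" "\<And>x. 0 \<le> v x" "AE x in lborel. 0 < v x"
    "AE x in lborel. w x = v x"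
    "\<And>x \<rho>. 0 < \<rho> \<Longrightarrow> integrable lborel (\<lambda>y. indicator (sup_cball \<rho>) (x - y) * v y)"
    "\<And>x \<rho>. 0 < \<rho> \<Longrightarrow> integrable lborel (\<lambda>y. indicator (sup_cball \<rho>) (x - y) * v y powr (- 1 / (p - 1)))"
    "\<And>x \<rho>. 0 < \<rho> \<Longrightarrow> (\<integral>y. indicator (sup_cball \<rho>) (x - y) * v y \<partial>lborel) *
        (\<integral>y. indicator (sup_cball \<rho>) (x - y) * v y powr (- 1 / (p - 1)) \<partial>lborel) powr (p - 1)
        \<le> A * \<rho> powr (CARD('n) * p)"
proof -
  have wm: "w \<in> borel_measurable lebesgue" and w0: "\<And>x. 0 \<le> w x" and wpos: "AE x in lebesgue. 0 < w x"
    and wint: "\<And>a l. 0 < l \<Longrightarrow> integrable (lebesgue_on (cube a l)) w"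
      "\<And>a l. 0 < l \<Longrightarrow> integrable (lebesgue_on (cube a l)) (\<lambda>x. w x powr (- 1 / (p - 1)))"
    using w unfolding muckenhoupt_def by auto
  obtain A where A: "\<And>a l. 0 < l \<Longrightarrow> average (cube a l) w *
        average (cube a l) (\<lambda>x. w x powr (- 1 / (p - 1))) powr (p - 1) \<le> A"
    using w unfolding muckenhoupt_def by auto
  obtain v0 where [measurable]: "v0 \<in> borel_measurable lborel" and v0: "AE x in lborel. w x = v0 x"
    using completion_ex_borel_measurable_real[OF wm] by blast
  define v where "v x = max 0 (v0 x)" for x
  have vm[measurable]: "v \<in> borel_measurable borel" unfolding v_def by measurable
  have ae: "AE x in lborel. w x = v x"
    using v0
  proof eventually_elim
    case (elim x) then show ?case using w0[of x] by (simp add: v_def max_def)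
  qed
  have ae': "AE x in lborel. w x powr (- 1 / (p - 1)) = v x powr (- 1 / (p - 1))"
    using ae by eventually_elim simp
  have vpos: "AE x in lborel. 0 < v x"
    using wpos ae unfolding AE_completion_iff by eventually_elim simp
  have cube_borel: "cube a l \<in> sets borel" for a :: "real^'n" and l by (simp add: cube_def)
  have ind: "indicator (sup_cball \<rho>) (x - y) = (indicator (cube (x - (\<chi> i. \<rho>)) (2 * \<rho>)) y :: real)" for \<rho> and x y :: "real^'n"
    using translated_sup_cball[of x \<rho>] by (auto simp: indicator_def)
  show ?thesis
  proof (rule that[of v "A * 2 powr (CARD('n) * p)"])
    fix x :: "real^'n" and \<rho> :: real assume \<rho>: "0 < \<rho>"
    let ?Q = "cube (x - (\<chi> i. \<rho>)) (2 * \<rho>)"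
    let ?\<sigma> = "\<lambda>x. v x powr (- 1 / (p - 1))"
    have sm: "?\<sigma> \<in> borel_measurable borel" by measurable
    note W = integral_borel_representative[OF cube_borel vm AE_lebesgue_on_if_AE_lborel[OF cube_borel ae]]
    note S = integral_borel_representative[OF cube_borel sm AE_lebesgue_on_if_AE_lborel[OF cube_borel ae']]
    show "integrable lborel (\<lambda>y. indicator (sup_cball \<rho>) (x - y) * v y)"
      unfolding ind using W(1) wint(1) \<rho> by simp
    show "integrable lborel (\<lambda>y. indicator (sup_cball \<rho>) (x - y) * ?\<sigma> y)"
      unfolding ind using S(1) wint(2) \<rho> by simp
    define W0 S0 V where "W0 = (\<integral>y. indicator ?Q y * v y \<partial>lborel)"
      and "S0 = (\<integral>y. indicator ?Q y * ?\<sigma> y \<partial>lborel)" and "V = (2 * \<rho>) ^ CARD('n)"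
    have V: "0 < V" using \<rho> by (simp add: V_def)
    have S0: "0 \<le> S0" unfolding S0_def by (intro Bochner_Integration.integral_nonneg) simp
    have "average ?Q w = W0 / V" "average ?Q (\<lambda>x. w x powr (- 1 / (p - 1))) = S0 / V"
      using \<rho> unfolding average_def W0_def S0_def V_def W(2) S(2) by (simp_all add: measure_cube(2))
    then have "W0 / V * (S0 / V) powr (p - 1) \<le> A" using A[of "2 * \<rho>" "x - (\<chi> i. \<rho>)"] \<rho> by simp
    then have "W0 / V * (S0 / V) powr (p - 1) * V powr p \<le> A * V powr p"
      by (rule mult_right_mono) simp
    moreover have "W0 / V * (S0 / V) powr (p - 1) * V powr p = W0 * S0 powr (p - 1)"
    proof -
      have "V powr p = V * V powr (p - 1)" using V powr_add[of V 1 "p - 1"] by simp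
      moreover have "(S0 / V) powr (p - 1) = S0 powr (p - 1) / V powr (p - 1)"
        using V S0 by (simp add: powr_divide)
      ultimately show ?thesis using V by simp
    qed
    moreover have "V powr p = 2 powr (CARD('n) * p) * \<rho> powr (CARD('n) * p)"
    proof -
      have "V = (2 * \<rho>) powr CARD('n)" using \<rho> by (simp add: V_def powr_realpow)
      then have "V powr p = (2 * \<rho>) powr (CARD('n) * p)" by (simp add: powr_powr)
      then show ?thesis using \<rho> by (simp add: powr_mult)
    qed
    ultimately show "(\<integral>y. indicator (sup_cball \<rho>) (x - y) * v y \<partial>lborel) *
        (\<integral>y. indicator (sup_cball \<rho>) (x - y) * ?\<sigma> y \<partial>lborel) powr (p - 1)
        \<le> A * 2 powr (CARD('n) * p) * \<rho> powr (CARD('n) * p)"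
      unfolding ind W0_def[symmetric] S0_def[symmetric] by (simp add: mult.assoc)
  qed (use ae vpos in \<open>simp_all add: v_def[abs_def]\<close>)
qed

lemma Lp_weightedI:
  fixes w v g h :: "real^'n::finite \<Rightarrow> real"
  assumes \<Omega>: "\<Omega> \<in> sets borel" and p: "1 < p" and [measurable]: "v \<in> borel_measurable borel"
    and v: "\<And>x. 0 \<le> v x" and wv: "AE x in lborel. w x = v x"
    and g[measurable]: "g \<in> borel_measurable borel" and hg: "AE x in lebesgue_on \<Omega>. h x = g x"
    and c: "0 \<le> c" and bound: "(\<integral>\<^sup>+x. ennreal (\<bar>g x\<bar> powr p * v x) \<partial>lborel) \<le> ennreal c"
  shows "h \<in> Lp_weighted \<Omega> w p" and "Lp_norm \<Omega> w p h \<le> c powr (1 / p)"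
proof -
  note [measurable] = \<Omega>
  let ?G = "\<lambda>x. \<bar>g x\<bar> powr p * v x"
  have ae: "AE x in lebesgue_on \<Omega>. \<bar>h x\<bar> powr p * w x = ?G x"
    using hg AE_lebesgue_on_if_AE_lborel[OF \<Omega> wv] by eventually_elim simp
  have Gm: "?G \<in> borel_measurable borel" by measurable
  have le: "(\<integral>\<^sup>+x. ennreal (indicator \<Omega> x * ?G x) \<partial>lborel) \<le> ennreal c"
    by (rule order_trans[OF nn_integral_mono bound]) (auto simp: indicator_def v)
  have "integrable lborel (\<lambda>x. indicator \<Omega> x * ?G x)"
  proof (rule integrableI_bounded)
    have "(\<integral>\<^sup>+x. ennreal (norm (indicator \<Omega> x * ?G x)) \<partial>lborel) = (\<integral>\<^sup>+x. ennreal (indicator \<Omega> x * ?G x) \<partial>lborel)"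
      using v by (intro nn_integral_cong) (simp add: abs_mult)
    then show "(\<integral>\<^sup>+x. ennreal (norm (indicator \<Omega> x * ?G x)) \<partial>lborel) < \<infinity>"
      using le le_less_trans by fastforce
  qed measurable
  note rep = integral_borel_representative[OF \<Omega> Gm ae] and this
  moreover have "h \<in> borel_measurable (lebesgue_on \<Omega>)"
    using \<Omega> g hg by (rule AE_eq_measurable_lebesgue_on)
  ultimately show "h \<in> Lp_weighted \<Omega> w p" by (simp add: Lp_weighted_def)
  have "integral\<^sup>L lborel (\<lambda>x. indicator \<Omega> x * ?G x) \<le> c"
    using c le v by (subst integral_eq_nn_integral) (auto intro!: enn2real_leI)
  moreover have "0 \<le> integral\<^sup>L lborel (\<lambda>x. indicator \<Omega> x * ?G x)"
    using v by (intro Bochner_Integration.integral_nonneg) simp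
  ultimately show "Lp_norm \<Omega> w p h \<le> c powr (1 / p)"
    unfolding Lp_norm_def rep(2) using p by (intro powr_mono2) auto
qed

lemma Lp_weighted_borel_representative:
  fixes w v f :: "real^'n::finite \<Rightarrow> real"
  assumes \<Omega>: "\<Omega> \<in> sets borel" and p: "1 < p" and [measurable]: "v \<in> borel_measurable borel"
    and v: "\<And>x. 0 \<le> v x" and wv: "AE x in lborel. w x = v x" and f: "f \<in> Lp_weighted \<Omega> w p"
  obtains g where "g \<in> borel_measurable borel" "AE x in lebesgue_on \<Omega>. f x = g x"
    "(\<integral>\<^sup>+x. ennreal (\<bar>g x\<bar> powr p * v x) \<partial>lborel) = ennreal (Lp_norm \<Omega> w p f powr p)"
    "\<And>x. x \<notin> \<Omega> \<Longrightarrow> g x = 0"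
proof -
  note [measurable] = \<Omega>
  have \<Omega>': "\<Omega> \<inter> space lebesgue \<in> sets lebesgue" using \<Omega> by auto
  have "f \<in> borel_measurable (lebesgue_on \<Omega>)" using f by (simp add: Lp_weighted_def)
  then have "(\<lambda>x. indicator \<Omega> x *\<^sub>R f x) \<in> borel_measurable lebesgue"
    by (simp only: borel_measurable_restrict_space_iff[OF \<Omega>'])
  then obtain g0 where [measurable]: "g0 \<in> borel_measurable lborel"
    and g0: "AE x in lborel. indicator \<Omega> x *\<^sub>R f x = g0 x"
    using completion_ex_borel_measurable_real by blast
  define g where "g x = indicator \<Omega> x * g0 x" for x
  have gm[measurable]: "g \<in> borel_measurable borel" unfolding g_def by measurable
  have "AE x in lebesgue_on \<Omega>. x \<in> \<Omega>" using \<Omega>' by (simp add: AE_restrict_space_iff)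
  with AE_lebesgue_on_if_AE_lborel[OF \<Omega> g0] have fg: "AE x in lebesgue_on \<Omega>. f x = g x"
    by eventually_elim (simp add: g_def)
  let ?G = "\<lambda>x. \<bar>g x\<bar> powr p * v x"
  have Gm: "?G \<in> borel_measurable borel" by measurable
  have "AE x in lebesgue_on \<Omega>. \<bar>f x\<bar> powr p * w x = ?G x"
    using fg AE_lebesgue_on_if_AE_lborel[OF \<Omega> wv] by eventually_elim simp
  note rep = integral_borel_representative[OF \<Omega> Gm this]
  have ind: "(\<lambda>x. indicator \<Omega> x * ?G x) = ?G" by (auto simp: g_def indicator_def fun_eq_iff)
  have "integrable (lebesgue_on \<Omega>) (\<lambda>x. \<bar>f x\<bar> powr p * w x)" using f by (simp add: Lp_weighted_def)
  then have "integrable lborel ?G" unfolding rep(1) ind .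
  then have "(\<integral>\<^sup>+x. ennreal (?G x) \<partial>lborel) = ennreal (integral\<^sup>L lborel ?G)"
    using v by (intro nn_integral_eq_integral) auto
  also have "integral\<^sup>L lborel ?G = Lp_norm \<Omega> w p f powr p"
    unfolding Lp_norm_def rep(2) ind using v p by (simp add: powr_powr Bochner_Integration.integral_nonneg)
  finally show ?thesis using that[OF gm fg] by (simp add: g_def)
qed

theorem mainTheorem6:
  fixes \<Omega> :: "(real^'n::finite) set"
    and m k :: nat
    and p :: real
    and w :: "real^'n \<Rightarrow> real"
    and R :: "real^'n \<Rightarrow> real^'n \<Rightarrow> real"
  assumes "1 \<le> m"
    and "open \<Omega>" and "bounded \<Omega>"
    and "(odd CARD('n) \<and> 3 \<le> CARD('n) \<and> CARD('n) \<le> 2 * m + 1) \<or>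
         (even CARD('n) \<and> 2 \<le> CARD('n) \<and> CARD('n) \<le> 2 * m)"
    and "real k \<le> max_order CARD('n) m"
    and "1 < p"
    and "muckenhoupt p w"
    and "polyharmonic_green \<Omega> m R"
    and "green_estimate \<Omega> m R"
  shows "\<exists>C. \<forall>f\<in>Lp_weighted \<Omega> w p.
           (AE x in lebesgue_on \<Omega>. integrable (lebesgue_on \<Omega>) (\<lambda>y. R x y * f y)) \<and>
           green_potential \<Omega> R f \<in> sobolev \<Omega> w k p \<and>
           sobolev_norm \<Omega> w k p (green_potential \<Omega> R f) \<le> C * Lp_norm \<Omega> w p f"
proof -
  note p = \<open>1 < p\<close> and \<Omega> = \<open>open \<Omega>\<close>
  have \<Omega>b[measurable]: "\<Omega> \<in> sets borel" using \<Omega> by simp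
  obtain d where d: "1 \<le> d" "\<And>x y. x \<in> \<Omega> \<Longrightarrow> y \<in> \<Omega> \<Longrightarrow> norm (x - y) \<le> d"
  proof -
    obtain e where "\<forall>x\<in>\<Omega>. \<forall>y\<in>\<Omega>. dist x y \<le> e" using assms(3) bounded_two_points by blast
    then show ?thesis using that[of "max e 1"] by (fastforce simp: dist_norm)
  qed
  obtain B where B: "0 \<le> B" "\<And>\<eta> x y. mi_order \<eta> \<le> k \<Longrightarrow> x \<in> \<Omega> \<Longrightarrow> y \<in> \<Omega> \<Longrightarrow> x \<noteq> y \<Longrightarrow>
        \<bar>mderiv \<eta> (\<lambda>z. R z y) x\<bar> \<le> B / norm (x - y)"
    using green_kernel_bound[OF assms(9,5) _ d] assms(4) by blast
  interpret singular_kernel \<Omega> R k d B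
    by unfold_locales (use assms(2,4,8) d B in \<open>auto simp: polyharmonic_green_def\<close>)
  obtain v A where vm[measurable]: "v \<in> borel_measurable borel" and v0: "\<And>x. 0 \<le> v x"
    and vpos: "AE x in lborel. 0 < v x" and wv: "AE x in lborel. w x = v x"
    and vint: "\<And>x \<rho>. 0 < \<rho> \<Longrightarrow> integrable lborel (\<lambda>y. indicator (sup_cball \<rho>) (x - y) * v y)"
    and \<sigma>int: "\<And>x \<rho>. 0 < \<rho> \<Longrightarrow> integrable lborel (\<lambda>y. indicator (sup_cball \<rho>) (x - y) * v y powr (- 1 / (p - 1)))"
    and Ap: "\<And>x \<rho>. 0 < \<rho> \<Longrightarrow> (\<integral>y. indicator (sup_cball \<rho>) (x - y) * v y \<partial>lborel) *
        (\<integral>y. indicator (sup_cball \<rho>) (x - y) * v y powr (- 1 / (p - 1)) \<partial>lborel) powr (p - 1)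
        \<le> A * \<rho> powr (CARD('n) * p)"
    by (rule muckenhoupt_borel_representative[OF assms(7) p]) blast
  obtain C0 where C0: "0 < C0" and bound: "\<And>f h. f \<in> borel_measurable borel \<Longrightarrow> (\<forall>y. 0 \<le> f y) \<Longrightarrow>
     h \<in> borel_measurable borel \<Longrightarrow> (\<forall>x. 0 \<le> h x) \<Longrightarrow>
     (AE x in lborel. ennreal (h x) \<le> (\<integral>\<^sup>+y. dyadic_kernel d x y * ennreal (f y) \<partial>lborel)) \<Longrightarrow>
     (\<integral>\<^sup>+x. ennreal (h x powr p * v x) \<partial>lborel) \<le> ennreal C0 * (\<integral>\<^sup>+y. ennreal (f y powr p * v y) \<partial>lborel)"
    using dyadic_potential_bound[OF dim p d_pos vm v0 vpos refl vint \<sigma>int Ap] by blast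
  define C1 where "C1 = C0 * B powr p"
  have C1: "0 \<le> C1" using C0 by (simp add: C1_def)
  define C where "C = real (card {\<eta> :: 'n \<Rightarrow> nat. mi_order \<eta> \<le> k}) * C1 powr (1 / p)"
  show ?thesis
  proof (intro exI[of _ C] ballI)
    fix f assume f: "f \<in> Lp_weighted \<Omega> w p"
    let ?N = "Lp_norm \<Omega> w p f"
    have N: "0 \<le> ?N" by (simp add: Lp_norm_def)
    obtain g where gm[measurable]: "g \<in> borel_measurable borel" and fg: "AE x in lebesgue_on \<Omega>. f x = g x"
      and gN: "(\<integral>\<^sup>+x. ennreal (\<bar>g x\<bar> powr p * v x) \<partial>lborel) = ennreal (?N powr p)"
      and g0: "\<And>x. x \<notin> \<Omega> \<Longrightarrow> g x = 0"
      using Lp_weighted_borel_representative[OF \<Omega>b p vm v0 wv f] by blast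
    (* Young's inequality with parameter 1 bounds |f| by |f|^p w + w^(-1/(p-1)), and the dual weight is integrable over cubes. *)
    have g_int: "integrable lborel g"
    proof -
      obtain \<rho> where \<rho>: "0 < \<rho>" "\<And>x. x \<in> \<Omega> \<Longrightarrow> norm x \<le> \<rho>"
        using assms(3) by (auto simp: bounded_pos)
      let ?s = "\<lambda>y. indicator (sup_cball \<rho>) (0 - y) * v y powr (- 1 / (p - 1))"
      have sb: "0 - x \<in> sup_cball \<rho>" if "x \<in> \<Omega>" for x
        using norm_le_in_sup_cball[of "0 - x" \<rho>] \<rho>(2)[OF that] by simp
      show ?thesis
      proof (rule Bochner_Integration.integrable_bound)
        have "integrable lborel (\<lambda>x. \<bar>g x\<bar> powr p * v x)"
          by (rule integrableI_bounded) (use gN v0 in \<open>auto simp: abs_mult\<close>)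
        then show "integrable lborel (\<lambda>x. \<bar>g x\<bar> powr p * v x + ?s x)"
          using \<sigma>int[OF \<rho>(1), of 0] by (intro Bochner_Integration.integrable_add)
        show "AE x in lborel. norm (g x) \<le> norm (\<bar>g x\<bar> powr p * v x + ?s x)"
          using vpos
        proof eventually_elim
          case (elim x)
          show ?case
          proof (cases "x \<in> \<Omega>")
            case True
            then show ?thesis using weighted_Young[of "\<bar>g x\<bar>" 1 "v x" p] elim p sb[OF True] by simp
          qed (simp add: g0)
        qed
      qed measurable
    qed
    let ?u = "green_potential \<Omega> R f" and ?P = "\<lambda>\<eta>. potential \<eta> g"
    have m0: "mi_order (\<lambda>_::'n. 0) = 0" by (simp add: mi_order_def)
    have md0: "mderiv (\<lambda>_. 0) h = h" for h :: "real^'n \<Rightarrow> real"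
      by (cases "\<lambda>_::'n. 0::nat" rule: mderiv_cases) (auto simp: m0)
    have Pm[measurable]: "?P \<eta> \<in> borel_measurable borel" if "mi_order \<eta> \<le> k" for \<eta>
      using potential_integrable(1)[OF that g_int] by auto
    (* For fixed x the integrands differ only on a null set: where f differs from g, and on the diagonal. *)
    have slice: "integrable (lebesgue_on \<Omega>) (\<lambda>y. R x y * f y) \<longleftrightarrow> integrable lborel (\<lambda>y. kernel_deriv (\<lambda>_. 0) x y * g y)"
      "?u x = ?P (\<lambda>_. 0) x" if x: "x \<in> \<Omega>" for x
    proof -
      have "AE y in lebesgue_on \<Omega>. y \<noteq> x"
        by (rule AE_lebesgue_on_if_AE_lborel[OF \<Omega>b AE_lborel_singleton])
      moreover have "AE y in lebesgue_on \<Omega>. y \<in> \<Omega>" using \<Omega>b by (simp add: AE_restrict_space_iff)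
      ultimately have ae: "AE y in lebesgue_on \<Omega>. R x y * f y = kernel_deriv (\<lambda>_. 0) x y * g y"
        using fg by eventually_elim (use x in \<open>auto simp: kernel_deriv_def md0\<close>)
      have km: "(\<lambda>y. kernel_deriv (\<lambda>_. 0) x y * g y) \<in> borel_measurable borel" by measurable
      have ind: "(\<lambda>y. indicator \<Omega> y * (kernel_deriv (\<lambda>_. 0) x y * g y)) = (\<lambda>y. kernel_deriv (\<lambda>_. 0) x y * g y)"
        using g0 by (auto simp: indicator_def fun_eq_iff)
      show "integrable (lebesgue_on \<Omega>) (\<lambda>y. R x y * f y) \<longleftrightarrow> integrable lborel (\<lambda>y. kernel_deriv (\<lambda>_. 0) x y * g y)"
        "?u x = ?P (\<lambda>_. 0) x"
        using integral_borel_representative[OF \<Omega>b km ae]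
        by (simp_all add: ind green_potential_def potential_def)
    qed
    have in_\<Omega>: "AE x in lebesgue_on \<Omega>. x \<in> \<Omega>" using \<Omega>b by (simp add: AE_restrict_space_iff)
    then have uP: "AE x in lebesgue_on \<Omega>. ?u x = ?P (\<lambda>_. 0) x"
      by eventually_elim (rule slice)
    have k0: "mi_order (\<lambda>_::'n. 0) \<le> k" by (simp add: m0)
    have 1: "AE x in lebesgue_on \<Omega>. integrable (lebesgue_on \<Omega>) (\<lambda>y. R x y * f y)"
      using in_\<Omega> AE_lebesgue_on_if_AE_lborel[OF \<Omega>b potential_integrable(2)[OF k0 g_int]]
      by eventually_elim (simp add: slice)
    have weak: "has_weak_deriv \<Omega> \<eta> ?u (?P \<eta>)" if \<eta>: "mi_order \<eta> \<le> k" for \<eta>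
      using \<Omega> potential_integrable(1)[OF k0 g_int] potential_integrable(1)[OF \<eta> g_int] uP
        potential_weak_derivative[OF \<eta> g_int] by (rule has_weak_derivI)
    (* The constant B of the kernel bound is attached to g, which puts the factor B^p in front. *)
    have P_bound: "(\<integral>\<^sup>+x. ennreal (\<bar>?P \<eta> x\<bar> powr p * v x) \<partial>lborel) \<le> ennreal (C1 * ?N powr p)" if \<eta>: "mi_order \<eta> \<le> k" for \<eta>
    proof -
      have "(\<integral>\<^sup>+x. ennreal (\<bar>?P \<eta> x\<bar> powr p * v x) \<partial>lborel)
         \<le> ennreal C0 * (\<integral>\<^sup>+y. ennreal ((B * \<bar>g y\<bar>) powr p * v y) \<partial>lborel)"
        by (rule bound) (use Pm[OF \<eta>] B(1) potential_bound[OF \<eta> gm] in auto)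
      also have "(\<integral>\<^sup>+y. ennreal ((B * \<bar>g y\<bar>) powr p * v y) \<partial>lborel) = (\<integral>\<^sup>+y. ennreal (B powr p) * ennreal (\<bar>g y\<bar> powr p * v y) \<partial>lborel)"
        using B(1) v0 by (intro nn_integral_cong) (simp add: powr_mult ennreal_mult[symmetric] mult.assoc)
      also have "\<dots> = ennreal (B powr p) * ennreal (?N powr p)"
        unfolding gN[symmetric] by (rule nn_integral_cmult) measurable
      also have "ennreal C0 * \<dots> = ennreal (C1 * ?N powr p)"
        using C0 by (simp add: C1_def ennreal_mult mult.assoc)
      finally show ?thesis .
    qed
    have c: "0 \<le> C1 * ?N powr p" using C1 by simp
    have Lp: "h \<in> Lp_weighted \<Omega> w p" "Lp_norm \<Omega> w p h \<le> C1 powr (1 / p) * ?N"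
      if \<eta>: "mi_order \<eta> \<le> k" and h: "AE x in lebesgue_on \<Omega>. h x = ?P \<eta> x" for \<eta> h
    proof -
      note * = Lp_weightedI[OF \<Omega>b p vm v0 wv Pm[OF \<eta>] h c P_bound[OF \<eta>]]
      show "h \<in> Lp_weighted \<Omega> w p" by (rule *)
      have "(C1 * ?N powr p) powr (1 / p) = C1 powr (1 / p) * ?N"
        using N p by (simp add: powr_mult powr_powr)
      then show "Lp_norm \<Omega> w p h \<le> C1 powr (1 / p) * ?N" using *(2) by simp
    qed
    have 2: "?u \<in> sobolev \<Omega> w k p"
      unfolding sobolev_def using Lp(1)[OF k0 uP] Lp(1)[of _ "?P _"] weak by auto
    have "sobolev_norm \<Omega> w k p ?u \<le> (\<Sum>\<eta> :: 'n \<Rightarrow> nat | mi_order \<eta> \<le> k. C1 powr (1 / p) * ?N)"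
      unfolding sobolev_norm_def
      by (intro sum_mono Lp(2)) (auto intro: weak_deriv_AE_eq[OF \<Omega> weak])
    also have "\<dots> = C * ?N" by (simp add: C_def)
    finally show "(AE x in lebesgue_on \<Omega>. integrable (lebesgue_on \<Omega>) (\<lambda>y. R x y * f y)) \<and>
        ?u \<in> sobolev \<Omega> w k p \<and> sobolev_norm \<Omega> w k p ?u \<le> C * ?N"
      using 1 2 by blast
  qed
qed

end
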